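(* Let $\mathcal{L}$ be a Lévy operator and fix $p\ge2$. Assume that for every $r\ge p$ the $r$-logarithmic Sobolev inequality $$\mathrm{Ent}(|f|^r)\le C(r)\|f\|_r^r+D(r)\,\mathcal{E}(|f|^{r-2}f,f)\qquad\text{for every } f \text{ with } |f|^{r/2}\in H_{\mathcal{L}}(\mathbb{R}^N)$$ holds, with $C(r)\in\mathbb{R}$ and $D(r)>0$. Let $q\in C^1([0,t_\infty);[p,\infty))$, $t_\infty\in(0,\infty]$, be the solution of $$q'(t)=\frac{q^2(t)}{D(q(t))},\qquad q(0)=p,\qquad \lim_{t\to t_\infty}q(t)=\infty ,$$ and let $$A_p(t)=\exp\left(\int_0^t\frac{C(q(s))}{D(q(s))}\,ds\right)=\exp\left(\int_p^{q(t)}\frac{C(\alpha)}{\alpha^2}\,d\alpha\right)$$ ($C$, $D$ being such that this solution exists and these integrals are well defined and finite for $t<t_\infty$). Then $\mathcal{L}$ is $p$-hypercontractive with exponents $q(t)$ and coefficients $A_p(t)$, that is, $$\|u(t)\|_{q(t)}\le A_p(t)\|u_0\|_p\qquad\text{for all }0\le t<t_\infty\text{ and } u_0\in L^p(\mathbb{R}^N).$$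
   Context: $L^p=L^p(\mathbb{R}^N)$ with Lebesgue measure and norm $\|\cdot\|_p$. A Lévy operator is $\mathcal{L}f(x)=\mathrm{P.V.}\int_{\mathbb{R}^N}(f(x)-f(y))J(x,y)\,dy$ with $J\ge0$ measurable, $J(x,y)=J(y,x)$ and $\sup_x\int J(x,y)\min\{1,|x-y|^2\}\,dy<\infty$. Set $\mathcal{E}(f,g)=\frac12\iint (f(x)-f(y))(g(x)-g(y))J(x,y)\,dx\,dy$, $\overline{\mathcal{E}}(f)=\mathcal{E}(f,f)$, and $H_{\mathcal{L}}(\mathbb{R}^N)=\{f\in L^2:\overline{\mathcal{E}}(f)<\infty\}$ with norm $\|f\|_2+\overline{\mathcal{E}}(f)^{1/2}$; $\mathcal{L}$ is understood as the self-adjoint operator on $L^2$ given by $\langle\mathcal{L}f,g\rangle=\mathcal{E}(f,g)$. For $u_0\in L^2$, the solution of $\partial_tu+\mathcal{L}u=0$, $u(0)=u_0$, is the unique $u\in C([0,\infty);L^2)\cap C^1((0,\infty);L^2)\cap C((0,\infty);H_{\mathcal{L}})$ satisfying $\frac{du}{dt}+\mathcal{L}u=0$ in $(0,\infty)$ and $u(0)=u_0$; write $e^{-t\mathcal{L}}u_0=u(t)$. This semigroup is self-adjoint, positivity preserving and contractive in every $L^p$-norm; for $u_0\in L^p$ the solution is defined by extending $e^{-t\mathcal{L}}$ continuously from $L^2\cap L^p$ to $L^p$. Entropy: $\mathrm{Ent}(f)=\int_{\mathbb{R}^N}\Phi(|f|)-\Phi\left(\int_{\mathbb{R}^N}|f|\right)$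 with $\Phi(s)=s\log s$ ($\Phi(0)=0$). *)

theory Defs
  imports "HOL-Analysis.Analysis"
begin

text \<open>
  The space $\mathbb{R}^N$ is an arbitrary type \<open>'a :: euclidean_space\<close>. Elements of $L^p$ are
  represented by measurable functions; every notion below is insensitive to changes on null sets.
\<close>

definition memLp :: "real \<Rightarrow> ('a::euclidean_space \<Rightarrow> real) \<Rightarrow> bool" where
  "memLp p f \<longleftrightarrow> f \<in> borel_measurable lborel \<and> integrable lborel (\<lambda>x. \<bar>f x\<bar> powr p)"

text \<open>Meaningful only together with \<open>memLp p f\<close>.\<close>

definition lpnorm :: "real \<Rightarrow> ('a::euclidean_space \<Rightarrow> real) \<Rightarrow> real" where
  "lpnorm p f = (\<integral>x. \<bar>f x\<bar> powr p \<partial>lborel) powr (1 / p)"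

text \<open>
  The Lebesgue integral with values in $[-\infty,\infty]$. It is well defined in the usual sense
  unless positive and negative part are both infinite, in which case the value is \<open>\<infinity>\<close>
  (the convention for \<open>\<infinity> - \<infinity>\<close> on \<^typ>\<open>ereal\<close>).
\<close>

definition ext_integral :: "'b measure \<Rightarrow> ('b \<Rightarrow> real) \<Rightarrow> ereal" where
  "ext_integral M h =
     enn2ereal (\<integral>\<^sup>+x. ennreal (h x) \<partial>M) - enn2ereal (\<integral>\<^sup>+x. ennreal (- h x) \<partial>M)"

definition levy_kernel :: "('a::euclidean_space \<Rightarrow> 'a \<Rightarrow> real) \<Rightarrow> bool" where
  "levy_kernel J \<longleftrightarrow>
     (\<lambda>(x, y). J x y) \<in> borel_measurable (lborel \<Otimes>\<^sub>M lborel) \<and>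
     (\<forall>x y. 0 \<le> J x y) \<and>
     (\<forall>x y. J x y = J y x) \<and>
     (SUP x. \<integral>\<^sup>+y. ennreal (J x y * min 1 ((norm (x - y))\<^sup>2)) \<partial>lborel) < \<infinity>"

text \<open>
  The bilinear form $\mathcal{E}$. It is extended valued because $\mathcal{E}(f,f)$, and also
  $\mathcal{E}(|f|^{r-2}f,f)$ for sign-changing $f$ with $|f|^{r/2} \in H_{\mathcal{L}}$, has a
  nonnegative integrand but may be infinite.
\<close>

definition energy ::
  "('a::euclidean_space \<Rightarrow> 'a \<Rightarrow> real) \<Rightarrow> ('a \<Rightarrow> real) \<Rightarrow> ('a \<Rightarrow> real) \<Rightarrow> ereal" where
  "energy J f g =
     ereal (1 / 2) * ext_integral (lborel \<Otimes>\<^sub>M lborel) (\<lambda>(x, y). (f x - f y) * (g x - g y) * J x y)"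

definition HL :: "('a::euclidean_space \<Rightarrow> 'a \<Rightarrow> real) \<Rightarrow> ('a \<Rightarrow> real) set" where
  "HL J = {f. memLp 2 f \<and> energy J f f < \<infinity>}"

definition HLnorm :: "('a::euclidean_space \<Rightarrow> 'a \<Rightarrow> real) \<Rightarrow> ('a \<Rightarrow> real) \<Rightarrow> real" where
  "HLnorm J f = lpnorm 2 f + sqrt (real_of_ereal (energy J f f))"

text \<open>
  The graph of the self-adjoint operator on $L^2$ associated with the form:
  \<open>levy_operator J f h\<close> says that $f$ is in the domain of $\mathcal{L}$ and $\mathcal{L}f = h$.
\<close>

definition levy_operator ::
  "('a::euclidean_space \<Rightarrow> 'a \<Rightarrow> real) \<Rightarrow> ('a \<Rightarrow> real) \<Rightarrow> ('a \<Rightarrow> real) \<Rightarrow> bool" where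
  "levy_operator J f h \<longleftrightarrow>
     f \<in> HL J \<and> memLp 2 h \<and>
     (\<forall>g\<in>HL J. energy J f g = ereal (\<integral>x. h x * g x \<partial>lborel))"

text \<open>
  The solution of $\partial_t u + \mathcal{L}u = 0$, $u(0) = u_0$ for $u_0 \in L^2$, in
  $C([0,\infty);L^2) \cap C^1((0,\infty);L^2) \cap C((0,\infty);H_{\mathcal{L}})$; here \<open>v\<close> is the
  derivative $du/dt$. Thus \<open>u t\<close> is $e^{-t\mathcal{L}}u_0$.
\<close>

definition l2_solution ::
  "('a::euclidean_space \<Rightarrow> 'a \<Rightarrow> real) \<Rightarrow> ('a \<Rightarrow> real) \<Rightarrow> (real \<Rightarrow> 'a \<Rightarrow> real) \<Rightarrow> bool" where
  "l2_solution J u0 u \<longleftrightarrow>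
     memLp 2 u0 \<and>
     (AE x in lborel. u 0 x = u0 x) \<and>
     (\<forall>t\<ge>0. memLp 2 (u t)) \<and>
     (\<forall>t\<ge>0. ((\<lambda>s. lpnorm 2 (\<lambda>x. u s x - u t x)) \<longlongrightarrow> 0) (at t within {0..})) \<and>
     (\<forall>t>0. u t \<in> HL J) \<and>
     (\<forall>t>0. ((\<lambda>s. HLnorm J (\<lambda>x. u s x - u t x)) \<longlongrightarrow> 0) (at t)) \<and>
     (\<exists>v. (\<forall>t>0. memLp 2 (v t)) \<and>
          (\<forall>t>0. ((\<lambda>h. lpnorm 2 (\<lambda>x. (u (t + h) x - u t x) / h - v t x)) \<longlongrightarrow> 0) (at 0)) \<and>
          (\<forall>t>0. ((\<lambda>s. lpnorm 2 (\<lambda>x. v s x - v t x)) \<longlongrightarrow> 0) (at t)) \<and>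
          (\<forall>t>0. levy_operator J (u t) (\<lambda>x. - v t x)))"

text \<open>
  The solution for $u_0 \in L^p$, i.e. the value at $u_0$ of the continuous extension of
  $e^{-t\mathcal{L}}$ from $L^2 \cap L^p$ to $L^p$: \<open>u t\<close> is the $L^p$-limit of
  $e^{-t\mathcal{L}}f_n$ for $f_n \in L^2 \cap L^p$ with $f_n \to u_0$ in $L^p$. By contractivity
  on $L^p$ the limit does not depend on the sequence, so asking for one sequence or for
  all of them is the same.
\<close>

definition lp_solution ::
  "('a::euclidean_space \<Rightarrow> 'a \<Rightarrow> real) \<Rightarrow> real \<Rightarrow> ('a \<Rightarrow> real) \<Rightarrow> (real \<Rightarrow> 'a \<Rightarrow> real) \<Rightarrow> bool" where
  "lp_solution J p u0 u \<longleftrightarrow>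
     memLp p u0 \<and>
     (\<forall>t\<ge>0. memLp p (u t) \<and>
        (\<exists>f w. (\<forall>n::nat. memLp p (f n) \<and> l2_solution J (f n) (w n) \<and> memLp p (w n t)) \<and>
               (\<lambda>n. lpnorm p (\<lambda>x. f n x - u0 x)) \<longlonglongrightarrow> 0 \<and>
               (\<lambda>n. lpnorm p (\<lambda>x. w n t x - u t x)) \<longlonglongrightarrow> 0))"

text \<open>Since \<open>ln 0 = 0\<close>, this has \<open>Phi 0 = 0\<close>.\<close>

definition Phi :: "real \<Rightarrow> real" where
  "Phi s = s * ln s"

text \<open>
  For integrable $f$. On $\mathbb{R}^N$ the integral of $\Phi(|f|)$ can then still be $-\infty$ or
  $+\infty$.
\<close>

definition Ent :: "('a::euclidean_space \<Rightarrow> real) \<Rightarrow> ereal" where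
  "Ent f = ext_integral lborel (\<lambda>x. Phi \<bar>f x\<bar>) - ereal (Phi (\<integral>x. \<bar>f x\<bar> \<partial>lborel))"

definition log_sobolev ::
  "('a::euclidean_space \<Rightarrow> 'a \<Rightarrow> real) \<Rightarrow> real \<Rightarrow> real \<Rightarrow> real \<Rightarrow> bool" where
  "log_sobolev J r c d \<longleftrightarrow>
     (\<forall>f\<in>borel_measurable lborel. (\<lambda>x. \<bar>f x\<bar> powr (r / 2)) \<in> HL J \<longrightarrow>
        Ent (\<lambda>x. \<bar>f x\<bar> powr r) \<le>
          ereal (c * lpnorm r f powr r) + ereal d * energy J (\<lambda>x. \<bar>f x\<bar> powr (r - 2) * f x) f)"

end

theory Submission
  imports Defs
begin

text \<open>
  Formally, the derivative of $\log\|u(t)\|_{q(t)}$ is bounded by $C(q)/D(q)$: the equation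
  contributes the term $-\mathcal{E}(|u|^{q-2}u,u)$, the variation of the exponent contributes the
  entropy, and $q' = q^2/D(q)$ is chosen so that the inequality combines the two exactly.

  For data in $L^2 \cap L^p$ it is not known beforehand that $u(t)$ belongs to $L^{q(t)}$. So
  $|s|^q$ is replaced by a function that is continued linearly beyond a level $k(t)$, and the
  inequality is applied to the truncation of $u$ at that level. The linear part leaves an error of
  size $\log k$ times the excess of the modified power over the truncated one, which no a priori
  estimate controls; but if $\log k$ decreases in time as the solution of a linear equation,
  the derivative of the modified power with respect to $k$ absorbs this error. As $k(T)$ may still
  be prescribed arbitrarily large, the truncation can be removed at the final time. Data
  in $L^p$ follow by Fatou's lemma.
\<close>

section \<open>Powers continued linearly beyond a truncation level\<close>

text \<open>Only L^2 differentiability of \<open>u\<close> in time is available, so the functional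
  must have quadratic growth and a Lipschitz derivative; the linear continuation provides both and
  keeps convexity. Put \<kappa> = ln k, let M and X be the integrals of the truncated power and of
  the excess, N = M + X, c = C(q), d = D(q). The inequality yields (c + ln N) M where (c + ln N) N
  is wanted, so X is multiplied by - c, by - ln N and by the factor 1 + r \<kappa> from varying the
  exponent beyond the level. The \<kappa>-derivative of N is exactly (r - 1) X, so \<kappa>' only
  has to beat an expression affine in \<kappa>; a linear equation does this and can be solved
  backwards from any \<kappa>(T) on all of [0,T]. The term - ln N needs a lower bound on N, which is
  at hand where N exceeds the claimed bound: hence a barrier argument. As c / d is only integrable
  in time, it is paid for up to a threshold B; the rest, max 0 (|c / d| - B), joins the rate and
  disappears as B grows. The L^2 norm controls the entropy of a truncation because r > 2, which
  holds for t > 0 by strict growth of q; at t = 0 continuity is enough.\<close>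

lemma powr_above_tangent:
  fixes x y e :: real
  assumes "1 \<le> e" "0 \<le> x" "0 \<le> y"
  shows "x powr e + e * x powr (e - 1) * (y - x) \<le> y powr e"
\<comment> \<open>The convexity argument below runs on the open half-line. At x = 0 the slope term
  is 0, also for e = 1 because \<open>0 powr 0 = 0\<close>.\<close>
proof (cases "x = 0 \<or> y = 0")
  case True
  then show ?thesis
  proof
    assume "y = 0"
    have "x powr e \<le> e * (x powr (e - 1) * x)"
    proof (cases "x = 0")
      case False
      then have "x powr (e - 1) * x = x powr e"
        using assms by (simp add: powr_diff)
      then show ?thesis
        using assms by (simp add: mult_le_cancel_right1)
    qed simp
    with \<open>y = 0\<close> show ?thesis
      using assms by (simp add: algebra_simps)
  qed (use assms in auto)
next
  case False
  with assms have "0 < x" "0 < y" by auto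
  have "y powr e - x powr e \<ge> (e * x powr (e - 1)) * (y - x)"
  proof (rule convex_on_imp_above_tangent[OF powr_convex[OF assms(1)]])
    show "((\<lambda>x. x powr e) has_field_derivative e * x powr (e - 1)) (at x within {0<..})"
      using \<open>0 < x\<close> by (auto intro!: derivative_eq_intros)
  qed (use \<open>0 < x\<close> \<open>0 < y\<close> in \<open>auto simp: interior_open\<close>)
  then show ?thesis by simp
qed

text \<open>The tangent at one point bounds the increment towards it, with slope at most e k^(e-1);
  exchanging the points gives the modulus.\<close>

lemma powr_lipschitz_on_interval:
  fixes x y e k :: real
  assumes "1 \<le> e" "0 \<le> x" "x \<le> k" "0 \<le> y" "y \<le> k"
  shows "\<bar>x powr e - y powr e\<bar> \<le> e * k powr (e - 1) * \<bar>x - y\<bar>"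
proof -
  have *: "b powr e - a powr e \<le> e * k powr (e - 1) * \<bar>b - a\<bar>"
    if "0 \<le> a" "a \<le> k" "0 \<le> b" "b \<le> k" for a b
  proof -
    have "b powr e - a powr e \<le> e * b powr (e - 1) * (b - a)"
      using powr_above_tangent[of e b a] assms that by (simp add: algebra_simps)
    also have "\<dots> \<le> e * b powr (e - 1) * \<bar>b - a\<bar>"
      using assms by (intro mult_left_mono) auto
    also have "\<dots> \<le> e * k powr (e - 1) * \<bar>b - a\<bar>"
      using assms that by (intro mult_right_mono mult_left_mono powr_mono2) auto
    finally show ?thesis .
  qed
  show ?thesis
    using *[of x y] *[of y x] assms by (auto simp: abs_le_iff abs_minus_commute)
qed

text \<open>
  \<open>lin_powr k r\<close> is \<open>\<bar>s\<bar> powr r\<close> continued beyond \<open>\<bar>s\<bar> = k\<close> along its tangent, and \<open>r * tpow k r\<close> is its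
  derivative, so that \<open>tpow k r s\<close> is $|f|^{r-2}f$ for the truncation $f$ of $s$. At \<open>r = 2\<close>
  the factor \<open>0 powr 0 = 0\<close> does no harm, since it is multiplied by \<open>trunc k s = 0\<close>.
\<close>

definition trunc :: "real \<Rightarrow> real \<Rightarrow> real" where
  "trunc k s = max (- k) (min k s)"

definition tpow :: "real \<Rightarrow> real \<Rightarrow> real \<Rightarrow> real" where
  "tpow k r s = \<bar>trunc k s\<bar> powr (r - 2) * trunc k s"

definition excess :: "real \<Rightarrow> real \<Rightarrow> real \<Rightarrow> real" where
  "excess k r s = r * k powr (r - 1) * (\<bar>s\<bar> - min \<bar>s\<bar> k)"

definition lin_powr :: "real \<Rightarrow> real \<Rightarrow> real \<Rightarrow> real" where
  "lin_powr k r s = min \<bar>s\<bar> k powr r + excess k r s"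

lemma abs_trunc: "0 \<le> k \<Longrightarrow> \<bar>trunc k s\<bar> = min \<bar>s\<bar> k"
  by (auto simp: trunc_def)

lemma trunc_measurable [measurable]: "trunc k \<in> borel_measurable borel"
  unfolding trunc_def by measurable

lemma tpow_measurable [measurable]: "tpow k r \<in> borel_measurable borel"
  unfolding tpow_def by measurable

lemma excess_measurable [measurable]: "excess k r \<in> borel_measurable borel"
  unfolding excess_def by measurable

lemma lin_powr_measurable [measurable]: "lin_powr k r \<in> borel_measurable borel"
  unfolding lin_powr_def by measurable

lemma tpow_eq:
  assumes "0 \<le> k" "2 \<le> r"
  shows "tpow k r s = sgn s * min \<bar>s\<bar> k powr (r - 1)"
proof (cases "trunc k s = 0")
  case True
  then have "s = 0 \<or> k = 0"
    using assms by (auto simp: trunc_def max_def min_def split: if_splits)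
  then show ?thesis
    using assms by (auto simp: tpow_def trunc_def)
next
  case False
  have "trunc k s = sgn s * \<bar>trunc k s\<bar>"
    using assms by (auto simp: trunc_def sgn_if)
  moreover have "\<bar>trunc k s\<bar> powr (r - 2) * \<bar>trunc k s\<bar> = \<bar>trunc k s\<bar> powr (r - 1)"
    using False powr_mult_base[of "\<bar>trunc k s\<bar>" "r - 2"] by (simp add: mult.commute)
  ultimately show ?thesis
    using assms by (metis abs_trunc mult.left_commute tpow_def)
qed

text \<open>The first two estimates serve to compare energies: \<open>tpow\<close> and
  \<open>trunc\<close> are both increasing, and truncation does not enlarge increments. The third is
  the bound (r - 1) k^(r-2) on the slope of s^(r-1) below the level; it gives
  \<open>lin_powr\<close> a quadratic remainder and lets \<open>tpow k r\<close> act on the form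
  domain.\<close>

lemma tpow_mono_lipschitz:
  assumes "0 < k" "2 \<le> r"
  shows "0 \<le> (tpow k r a - tpow k r b) * (trunc k a - trunc k b)" (is ?A)
    and "(tpow k r a - tpow k r b) * (trunc k a - trunc k b) \<le> (tpow k r a - tpow k r b) * (a - b)" (is ?B)
    and "\<bar>tpow k r a - tpow k r b\<bar> \<le> (r - 1) * k powr (r - 2) * \<bar>a - b\<bar>" (is ?C)
proof -
  have mono: "tpow k r b \<le> tpow k r a" if "b \<le> a" for a b
  proof -
    consider "0 \<le> b" | "b < 0" "0 \<le> a" | "a < 0" using that by linarith
    then show ?thesis
    proof cases
      case 1
      then show ?thesis using that assms
        by (auto simp: tpow_eq sgn_if intro!: powr_mono2)
    next
      case 2
      then show ?thesis using assms
        by (auto simp: tpow_eq sgn_if intro: order.trans[of _ 0])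
    next
      case 3
      then show ?thesis using that assms
        by (auto simp: tpow_eq sgn_if intro!: powr_mono2)
    qed
  qed
  have mono': "trunc k b \<le> trunc k a" "trunc k a - trunc k b \<le> a - b" if "b \<le> a" for a b
    using that assms by (auto simp: trunc_def)
  have *: "0 \<le> (tpow k r a - tpow k r b) * (trunc k a - trunc k b) \<and>
    (tpow k r a - tpow k r b) * (trunc k a - trunc k b) \<le> (tpow k r a - tpow k r b) * (a - b)"
    if "b \<le> a" for a b
    using mono[OF that] mono'[OF that] by (auto intro!: mult_nonneg_nonneg mult_left_mono)
  show ?A ?B
    using *[of a b] *[of b a] by (cases "b \<le> a"; simp add: algebra_simps)+
  have k2: "k powr (r - 2) \<le> (r - 1) * k powr (r - 2)"
    using assms by (simp add: mult_le_cancel_right1)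
  have m: "\<bar>min \<bar>a\<bar> k - min \<bar>b\<bar> k\<bar> \<le> \<bar>\<bar>a\<bar> - \<bar>b\<bar>\<bar>" by linarith
  have same: "\<bar>min \<bar>a\<bar> k powr (r - 1) - min \<bar>b\<bar> k powr (r - 1)\<bar> \<le> (r - 1) * k powr (r - 2) * \<bar>\<bar>a\<bar> - \<bar>b\<bar>\<bar>"
  proof -
    have "\<bar>min \<bar>a\<bar> k powr (r - 1) - min \<bar>b\<bar> k powr (r - 1)\<bar>
        \<le> (r - 1) * k powr (r - 1 - 1) * \<bar>min \<bar>a\<bar> k - min \<bar>b\<bar> k\<bar>"
      using assms by (intro powr_lipschitz_on_interval) auto
    also have "\<dots> \<le> (r - 1) * k powr (r - 2) * \<bar>\<bar>a\<bar> - \<bar>b\<bar>\<bar>"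
      using m assms by (simp add: mult_left_mono)
    finally show ?thesis .
  qed
  have one: "min \<bar>c\<bar> k powr (r - 1) \<le> (r - 1) * k powr (r - 2) * \<bar>c\<bar>" for c
  proof -
    have "min \<bar>c\<bar> k powr (r - 1) = min \<bar>c\<bar> k * min \<bar>c\<bar> k powr (r - 2)"
      using assms powr_mult_base[of "min \<bar>c\<bar> k" "r - 2"] by simp
    also have "\<dots> \<le> \<bar>c\<bar> * k powr (r - 2)"
      using assms by (intro mult_mono powr_mono2) auto
    also have "\<dots> \<le> \<bar>c\<bar> * ((r - 1) * k powr (r - 2))"
      by (intro mult_left_mono k2) auto
    finally show ?thesis by (simp add: mult_ac)
  qed
  \<comment> \<open>For equal signs this is the estimate on moduli. For opposite signs the distance
    is the sum of the moduli, so each value is compared with 0 separately.\<close>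
  show ?C
  proof (cases "a * b \<ge> 0")
    case True
    then consider "a = 0" | "b = 0" | "0 < a" "0 < b" | "a < 0" "b < 0"
      unfolding zero_le_mult_iff by linarith
    then show ?thesis
      using same one[of a] one[of b] assms
      by cases (auto simp: tpow_eq abs_minus_commute abs_mult abs_sgn_eq)
  next
    case False
    then have ab: "\<bar>a - b\<bar> = \<bar>a\<bar> + \<bar>b\<bar>"
      by (auto simp: zero_le_mult_iff)
    have t: "\<bar>tpow k r c\<bar> \<le> (r - 1) * k powr (r - 2) * \<bar>c\<bar>" for c
      using one[of c] assms by (auto simp: tpow_eq abs_mult abs_sgn_eq)
    show ?thesis
      using t[of a] t[of b] abs_triangle_ineq4[of "tpow k r a" "tpow k r b"]
      unfolding ab distrib_left by linarith
  qed
qed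

lemma tpow_0 [simp]: "0 < k \<Longrightarrow> tpow k r 0 = 0"
  by (simp add: tpow_def trunc_def)

lemma abs_tpow_le:
  assumes "0 < k" "2 \<le> r"
  shows "\<bar>tpow k r s\<bar> \<le> (r - 1) * k powr (r - 2) * \<bar>s\<bar>"
  using tpow_mono_lipschitz(3)[OF assms, of s 0] assms by simp

lemma excess_nonneg: "0 < k \<Longrightarrow> 0 \<le> r \<Longrightarrow> 0 \<le> excess k r s"
  by (auto simp: excess_def)

lemma lin_powr_nonneg: "0 < k \<Longrightarrow> 0 \<le> r \<Longrightarrow> 0 \<le> lin_powr k r s"
  by (simp add: lin_powr_def excess_nonneg)

text \<open>A tangent of a convex function lies below it. Hence the modified power of the initial
  datum is bounded by its p-norm, whatever the initial level.\<close>

lemma lin_powr_le_powr: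
  assumes "0 < k" "1 \<le> r"
  shows "lin_powr k r s \<le> \<bar>s\<bar> powr r"
  using powr_above_tangent[of r k "\<bar>s\<bar>"] assms by (auto simp: lin_powr_def excess_def min_def)

text \<open>Convexity, checked by pieces on the half-line of moduli: the constant slope beyond k
  dominates every slope below k. The passage to moduli uses sgn a (b - a) \<le> |b| - |a| and that
  the slope there is nonnegative.\<close>

lemma lin_powr_subgradient:
  assumes "0 < k" "2 \<le> r"
  shows "lin_powr k r a + r * tpow k r a * (b - a) \<le> lin_powr k r b"
proof -
  define x y where "x = \<bar>a\<bar>" and "y = \<bar>b\<bar>"
  have "x \<ge> 0" "y \<ge> 0" by (auto simp: x_def y_def)
  have "sgn a * (b - a) \<le> y - x"
    by (auto simp: x_def y_def sgn_if)
  then have "r * min x k powr (r - 1) * (sgn a * (b - a)) \<le> r * min x k powr (r - 1) * (y - x)"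
    using assms by (intro mult_left_mono) auto
  then have 1: "r * tpow k r a * (b - a) \<le> r * min x k powr (r - 1) * (y - x)"
    using assms by (simp add: tpow_eq x_def mult_ac)
  have 2: "min x k powr r + r * k powr (r - 1) * (x - min x k) + r * min x k powr (r - 1) * (y - x)
        \<le> min y k powr r + r * k powr (r - 1) * (y - min y k)"
  proof (cases "x \<le> k"; cases "y \<le> k")
    assume "x \<le> k" "y \<le> k"
    then show ?thesis
      using powr_above_tangent[of r x y] assms \<open>x \<ge> 0\<close> \<open>y \<ge> 0\<close> by simp
  next
    assume h: "x \<le> k" "\<not> y \<le> k"
    have "r * x powr (r - 1) * (y - k) \<le> r * k powr (r - 1) * (y - k)"
      using h assms \<open>x \<ge> 0\<close> by (intro mult_right_mono mult_left_mono powr_mono2) auto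
    then show ?thesis
      using powr_above_tangent[of r x k] assms \<open>x \<ge> 0\<close> h by (simp add: algebra_simps)
  next
    assume h: "\<not> x \<le> k" "y \<le> k"
    then show ?thesis
      using powr_above_tangent[of r k y] assms \<open>y \<ge> 0\<close> h by (simp add: algebra_simps)
  next
    assume "\<not> x \<le> k" "\<not> y \<le> k"
    then show ?thesis by (simp add: algebra_simps)
  qed
  show ?thesis
    using 1 2 by (simp add: lin_powr_def excess_def x_def y_def)
qed

text \<open>The subgradient inequality at both end points replaces a second derivative.\<close>

lemma lin_powr_taylor:
  assumes "0 < k" "2 \<le> r"
  shows "\<bar>lin_powr k r b - lin_powr k r a - r * tpow k r a * (b - a)\<bar>
           \<le> r * ((r - 1) * k powr (r - 2)) * (b - a)\<^sup>2"
proof -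
  have "lin_powr k r b - lin_powr k r a - r * tpow k r a * (b - a) \<le> r * ((tpow k r b - tpow k r a) * (b - a))"
    using lin_powr_subgradient[OF assms, of b a] by (simp add: algebra_simps)
  also have "\<dots> \<le> r * (((r - 1) * k powr (r - 2) * \<bar>b - a\<bar>) * \<bar>b - a\<bar>)"
  proof -
    have "(tpow k r b - tpow k r a) * (b - a) \<le> \<bar>tpow k r b - tpow k r a\<bar> * \<bar>b - a\<bar>"
      by (metis abs_ge_self abs_mult)
    also have "\<dots> \<le> ((r - 1) * k powr (r - 2) * \<bar>b - a\<bar>) * \<bar>b - a\<bar>"
      by (intro mult_right_mono tpow_mono_lipschitz assms) auto
    finally show ?thesis using assms by (intro mult_left_mono) auto
  qed
  also have "\<dots> = r * ((r - 1) * k powr (r - 2)) * (b - a)\<^sup>2"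
    by (simp add: power2_eq_square mult_ac flip: abs_mult)
  finally show ?thesis
    using lin_powr_subgradient[OF assms, of a b] by simp
qed

lemma lin_powr_le_square:
  assumes "0 < k" "2 \<le> r"
  shows "lin_powr k r s \<le> r * ((r - 1) * k powr (r - 2)) * s\<^sup>2"
proof -
  have "lin_powr k r 0 = 0" using assms by (simp add: lin_powr_def excess_def)
  then show ?thesis
    using lin_powr_taylor[OF assms, of s 0] assms by simp
qed

section \<open>Variation of the level and the exponent\<close>

text \<open>Both difference quotients have the same limit, however often \<open>P\<close> changes
  along the way. This covers the point |s| = exp (\<kappa> t), where the active branch of
  \<open>lin_powr\<close> may switch infinitely often as time approaches t.\<close>

lemma has_real_derivative_If_agree:
  fixes f g :: "real \<Rightarrow> real"
  assumes "(f has_real_derivative d) (at t)" "(g has_real_derivative d) (at t)" "f t = g t"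
  shows "((\<lambda>s. if P s then f s else g s) has_real_derivative d) (at t)"
proof -
  have "((\<lambda>h. if P (t + h) then (f (t + h) - f t) / h else (g (t + h) - g t) / h) \<longlongrightarrow> d) (at 0)"
    using assms(1,2) unfolding DERIV_def
    by (intro filterlim_If) (auto intro: filterlim_mono[OF _ order_refl inf_le1])
  moreover have "(if P (t + h) then (f (t + h) - f t) / h else (g (t + h) - g t) / h) =
      ((if P (t + h) then f (t + h) else g (t + h)) - (if P t then f t else g t)) / h" for h
    using assms(3) by simp
  ultimately show ?thesis
    unfolding DERIV_def by simp
qed

text \<open>Time derivative at fixed s for level exp \<kappa> and exponent r. The factor r' / r
  collects the variation of the exponent: k^r contributes \<open>Phi\<close>, the slope of the
  linear part contributes 1 + r \<kappa>. Varying \<kappa> leaves only (r - 1) times the excess,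
  because the changes of k^r and of the base point of the tangent cancel.\<close>

definition lin_powr_dt :: "real \<Rightarrow> real \<Rightarrow> real \<Rightarrow> real \<Rightarrow> real \<Rightarrow> real" where
  "lin_powr_dt \<kappa> \<kappa>' r r' s =
     r' / r * (Phi (min \<bar>s\<bar> (exp \<kappa>) powr r) + (1 + r * \<kappa>) * excess (exp \<kappa>) r s)
     + (r - 1) * \<kappa>' * excess (exp \<kappa>) r s"

lemma has_real_derivative_lin_powr:
  fixes \<kappa> q :: "real \<Rightarrow> real"
  assumes k: "(\<kappa> has_real_derivative \<kappa>') (at t)" and q: "(q has_real_derivative q') (at t)"
    and r: "0 < q t"
  shows "((\<lambda>\<tau>. lin_powr (exp (\<kappa> \<tau>)) (q \<tau>) s) has_real_derivative
           lin_powr_dt (\<kappa> t) \<kappa>' (q t) q' s) (at t)"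
proof (cases "s = 0")
  case True
  then show ?thesis
    by (simp add: lin_powr_def excess_def lin_powr_dt_def Phi_def)
next
  case False
  define \<sigma> where "\<sigma> = \<bar>s\<bar>"
  have "\<sigma> > 0" using False by (simp add: \<sigma>_def)
  define a where "a = (\<lambda>\<tau>. exp (q \<tau> * ln \<sigma>))"
  define b where "b = (\<lambda>\<tau>. exp (q \<tau> * \<kappa> \<tau>) + q \<tau> * exp ((q \<tau> - 1) * \<kappa> \<tau>) * (\<sigma> - exp (\<kappa> \<tau>)))"
  define d where "d = lin_powr_dt (\<kappa> t) \<kappa>' (q t) q' s"
  have eq: "(\<lambda>\<tau>. lin_powr (exp (\<kappa> \<tau>)) (q \<tau>) s) = (\<lambda>\<tau>. if \<sigma> \<le> exp (\<kappa> \<tau>) then a \<tau> else b \<tau>)"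
    using \<open>\<sigma> > 0\<close>
    by (auto simp: fun_eq_iff a_def b_def lin_powr_def excess_def \<sigma>_def powr_def min_def)
  have da: "(a has_real_derivative d) (at t)" if "\<sigma> \<le> exp (\<kappa> t)"
  proof -
    have "d = q' * ln \<sigma> * exp (q t * ln \<sigma>)"
      using that r \<open>\<sigma> > 0\<close>
      by (auto simp: d_def lin_powr_dt_def excess_def min_def Phi_def powr_def \<sigma>_def)
    then show ?thesis
      unfolding a_def using q by (auto intro!: derivative_eq_intros)
  qed
  have db: "(b has_real_derivative d) (at t)" if "exp (\<kappa> t) \<le> \<sigma>"
  proof -
    define E where "E = exp ((q t - 1) * \<kappa> t)"
    define F where "F = exp (\<kappa> t)"
    have EF: "exp (q t * \<kappa> t) = E * F"
      by (simp add: E_def F_def algebra_simps flip: exp_add)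
    have m: "min \<sigma> (exp (\<kappa> t)) = F"
      using that by (simp add: F_def)
    have d: "d = q' * \<kappa> t * (E * F) + q' * (1 + q t * \<kappa> t) * E * (\<sigma> - F) + (q t - 1) * \<kappa>' * (q t * E * (\<sigma> - F))"
    proof -
      have x: "excess F (q t) s = q t * E * (\<sigma> - F)"
        using m by (simp add: excess_def \<sigma>_def[symmetric] F_def E_def powr_def)
      have "F powr q t = E * F"
        using EF by (simp add: F_def powr_def)
      moreover have "ln (E * F) = q t * \<kappa> t"
        by (metis EF ln_exp)
      ultimately have P: "Phi (min \<sigma> F powr q t) = E * F * (q t * \<kappa> t)"
        using m by (simp add: Phi_def F_def)
      show ?thesis
        unfolding d_def lin_powr_dt_def F_def[symmetric] \<sigma>_def[symmetric] x P
        using r by (simp add: field_simps)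
    qed
    have "(b has_real_derivative (q' * \<kappa> t + \<kappa>' * q t) * (E * F) + ((q' * E + (q' * \<kappa> t + \<kappa>' * (q t - 1)) * E * q t) * (\<sigma> - F)
        + (- (\<kappa>' * F)) * (q t * E))) (at t)"
      unfolding b_def E_def F_def EF[symmetric, unfolded E_def F_def]
      using q k by (auto intro!: derivative_eq_intros simp: algebra_simps)
    then show ?thesis
      by (rule DERIV_cong) (simp add: d algebra_simps)
  qed
  have contk: "(\<kappa> \<longlongrightarrow> \<kappa> t) (nhds t)"
    using DERIV_isCont[OF k] by (simp add: isCont_def tendsto_at_iff_tendsto_nhds)
  have contk': "((\<lambda>\<tau>. exp (\<kappa> \<tau>)) \<longlongrightarrow> exp (\<kappa> t)) (nhds t)"
    by (intro tendsto_exp contk)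
  show ?thesis
    unfolding eq d_def[symmetric]
  proof (cases \<sigma> "exp (\<kappa> t)" rule: linorder_cases)
    case less
    then have "\<forall>\<^sub>F \<tau> in nhds t. (if \<sigma> \<le> exp (\<kappa> \<tau>) then a \<tau> else b \<tau>) = a \<tau>"
      using order_tendstoD(1)[OF contk' less] by (auto elim!: eventually_mono)
    from DERIV_cong_ev[OF refl this refl]
    show "((\<lambda>\<tau>. if \<sigma> \<le> exp (\<kappa> \<tau>) then a \<tau> else b \<tau>) has_real_derivative d) (at t)"
      using da less by simp
  next
    case greater
    then have "\<forall>\<^sub>F \<tau> in nhds t. (if \<sigma> \<le> exp (\<kappa> \<tau>) then a \<tau> else b \<tau>) = b \<tau>"
      using order_tendstoD(2)[OF contk' greater] by (auto elim!: eventually_mono)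
    from DERIV_cong_ev[OF refl this refl]
    show "((\<lambda>\<tau>. if \<sigma> \<le> exp (\<kappa> \<tau>) then a \<tau> else b \<tau>) has_real_derivative d) (at t)"
      using db greater by simp
  next
    case equal
    then have "ln \<sigma> = \<kappa> t" by simp
    then show "((\<lambda>\<tau>. if \<sigma> \<le> exp (\<kappa> \<tau>) then a \<tau> else b \<tau>) has_real_derivative d) (at t)"
      using equal by (intro has_real_derivative_If_agree da db) (auto simp: a_def b_def)
  qed
qed

text \<open>For small m the logarithm is absorbed by the surplus power: ln x \<le> x - 1 at x =
  m^(-(r-2)) gives m^(r-2) |ln m| \<le> 1 / (r - 2), which is where r > 2 enters. For m > 1 the
  level bounds both factors.\<close>

lemma Phi_powr_bound:
  assumes "2 < r" "0 \<le> \<kappa>" "0 \<le> m" "m \<le> exp \<kappa>"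
  shows "\<bar>Phi (m powr r)\<bar> \<le> r * (1 / (r - 2) + \<kappa> * exp (r * \<kappa>)) * m\<^sup>2"
proof (cases "m = 0")
  case False
  with assms have "m > 0" by simp
  have mr: "m powr r = m\<^sup>2 * m powr (r - 2)"
    using \<open>m > 0\<close> by (simp add: powr_diff)
  have "m powr (r - 2) * \<bar>ln m\<bar> \<le> 1 / (r - 2) + \<kappa> * exp (r * \<kappa>)"
  proof (cases "m \<le> 1")
    case True
    have "(r - 2) * (- ln m) = ln (m powr (- (r - 2)))"
      using \<open>m > 0\<close> by (simp add: ln_powr algebra_simps)
    also have "\<dots> \<le> m powr (- (r - 2)) - 1"
      using \<open>m > 0\<close> by (intro ln_le_minus_one) auto
    finally have "(r - 2) * (- ln m) \<le> m powr (- (r - 2))" by simp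
    then have "m powr (r - 2) * ((r - 2) * (- ln m)) \<le> m powr (r - 2) * m powr (- (r - 2))"
      by (intro mult_left_mono) auto
    also have "\<dots> = 1" using \<open>m > 0\<close> by (simp flip: powr_add)
    finally have "m powr (r - 2) * \<bar>ln m\<bar> \<le> 1 / (r - 2)"
      using assms True \<open>m > 0\<close> by (simp add: field_simps)
    then show ?thesis using assms by (simp add: add_increasing2)
  next
    case False
    have "m powr (r - 2) \<le> exp \<kappa> powr r"
      using False assms by (intro order.trans[OF powr_mono2 powr_mono]) auto
    moreover have "\<bar>ln m\<bar> \<le> \<kappa>"
      using False assms \<open>m > 0\<close> by (metis abs_of_nonneg ln_exp ln_ge_zero ln_mono not_le order_le_less_trans less_imp_le)
    ultimately have "m powr (r - 2) * \<bar>ln m\<bar> \<le> exp (r * \<kappa>) * \<kappa>"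
      by (intro mult_mono) (auto simp: powr_def)
    then show ?thesis using assms by (simp add: mult.commute add_increasing)
  qed
  then have "r * m\<^sup>2 * (m powr (r - 2) * \<bar>ln m\<bar>) \<le> r * m\<^sup>2 * (1 / (r - 2) + \<kappa> * exp (r * \<kappa>))"
    using assms by (intro mult_left_mono) auto
  moreover have "\<bar>Phi (m powr r)\<bar> = r * m\<^sup>2 * (m powr (r - 2) * \<bar>ln m\<bar>)"
    using assms \<open>m > 0\<close> unfolding Phi_def mr by (simp add: ln_powr abs_mult ln_mult powr_diff)
  ultimately show ?thesis by (simp add: mult_ac)
qed (simp add: Phi_def)

lemma excess_le_square:
  assumes "0 \<le> \<kappa>" "2 \<le> r" "r \<le> R"
  shows "excess (exp \<kappa>) r s \<le> R * (R * exp (R * \<kappa>)) * s\<^sup>2"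
proof -
  have "excess (exp \<kappa>) r s \<le> lin_powr (exp \<kappa>) r s"
    by (simp add: lin_powr_def)
  also have "\<dots> \<le> r * ((r - 1) * exp \<kappa> powr (r - 2)) * s\<^sup>2"
    using assms by (intro lin_powr_le_square) auto
  also have "\<dots> \<le> R * (R * exp (R * \<kappa>)) * s\<^sup>2"
    using assms by (intro mult_right_mono mult_mono) (auto simp: powr_def intro!: mult_right_mono)
  finally show ?thesis .
qed

text \<open>The constant depends only on the ranges of the parameters, so a multiple of w^2
  dominates the time difference quotients at fixed w throughout a time interval.\<close>

lemma lin_powr_dt_bound:
  assumes "2 < r0" "r0 \<le> r" "r \<le> R" "0 \<le> \<kappa>" "\<kappa> \<le> K" "\<bar>r'\<bar> \<le> Q" "\<bar>\<kappa>'\<bar> \<le> Q"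
  shows "\<bar>lin_powr_dt \<kappa> \<kappa>' r r' s\<bar> \<le>
     (Q * (R * (1 / (r0 - 2) + K * exp (R * K)) + (1 + R * K) * (R * (R * exp (R * K))))
       + R * Q * (R * (R * exp (R * K)))) * s\<^sup>2"
proof -
  define m where "m = min \<bar>s\<bar> (exp \<kappa>)"
  define x where "x = excess (exp \<kappa>) r s"
  have RK: "r * \<kappa> \<le> R * K" using assms by (intro mult_mono) auto
  have m2: "m\<^sup>2 \<le> s\<^sup>2"
    unfolding m_def by (subst power2_abs[of s, symmetric], rule power_mono) auto
  have x0: "0 \<le> x" unfolding x_def using assms by (intro excess_nonneg) auto
  have "x \<le> R * (R * exp (R * \<kappa>)) * s\<^sup>2"
    unfolding x_def using assms by (intro excess_le_square) auto
  also have "\<dots> \<le> R * (R * exp (R * K)) * s\<^sup>2"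
    using assms by (intro mult_right_mono mult_left_mono) auto
  finally have x: "x \<le> R * (R * exp (R * K)) * s\<^sup>2" .
  have "\<bar>Phi (m powr r)\<bar> \<le> r * (1 / (r - 2) + \<kappa> * exp (r * \<kappa>)) * m\<^sup>2"
    unfolding m_def using assms by (intro Phi_powr_bound) auto
  also have "\<dots> \<le> R * (1 / (r0 - 2) + K * exp (R * K)) * s\<^sup>2"
    using assms RK m2 by (intro mult_mono add_mono divide_left_mono) (auto intro!: mult_nonneg_nonneg add_nonneg_nonneg)
  finally have P: "\<bar>Phi (m powr r)\<bar> \<le> R * (1 / (r0 - 2) + K * exp (R * K)) * s\<^sup>2" .
  have Q0: "0 \<le> Q" using assms by linarith
  have "\<bar>r' / r\<bar> \<le> Q"
  proof -
    have "\<bar>r' / r\<bar> \<le> \<bar>r'\<bar> / 1"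
      using assms unfolding abs_divide by (intro divide_left_mono) auto
    then show ?thesis using assms by simp
  qed
  moreover have "\<bar>Phi (m powr r) + (1 + r * \<kappa>) * x\<bar> \<le>
      R * (1 / (r0 - 2) + K * exp (R * K)) * s\<^sup>2 + (1 + R * K) * (R * (R * exp (R * K)) * s\<^sup>2)"
  proof -
    have "\<bar>(1 + r * \<kappa>) * x\<bar> \<le> (1 + R * K) * (R * (R * exp (R * K)) * s\<^sup>2)"
      using x x0 RK assms unfolding abs_mult by (intro mult_mono) auto
    then show ?thesis using P by linarith
  qed
  ultimately have 1: "\<bar>r' / r * (Phi (m powr r) + (1 + r * \<kappa>) * x)\<bar> \<le>
     Q * (R * (1 / (r0 - 2) + K * exp (R * K)) * s\<^sup>2 + (1 + R * K) * (R * (R * exp (R * K)) * s\<^sup>2))"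
    unfolding abs_mult[of "r' / r"] using Q0 by (intro mult_mono) auto
  have 2: "\<bar>(r - 1) * \<kappa>' * x\<bar> \<le> R * Q * (R * (R * exp (R * K)) * s\<^sup>2)"
    unfolding abs_mult using x x0 assms Q0 by (intro mult_mono) auto
  have "\<bar>lin_powr_dt \<kappa> \<kappa>' r r' s\<bar> \<le>
     Q * (R * (1 / (r0 - 2) + K * exp (R * K)) * s\<^sup>2 + (1 + R * K) * (R * (R * exp (R * K)) * s\<^sup>2))
      + R * Q * (R * (R * exp (R * K)) * s\<^sup>2)"
    unfolding lin_powr_dt_def m_def[symmetric] x_def[symmetric]
    using 1 2 by linarith
  then show ?thesis by (simp add: algebra_simps)
qed

section \<open>Square-integrable functions and the Cauchy-Schwarz inequality\<close>

lemma memLp_2_iff: "memLp 2 f \<longleftrightarrow> f \<in> borel_measurable lborel \<and> integrable lborel (\<lambda>x. (f x)\<^sup>2)"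
  by (simp add: memLp_def)

lemma lpnorm_2: "lpnorm 2 f = sqrt (\<integral>x. (f x)\<^sup>2 \<partial>lborel)"
  by (simp add: lpnorm_def powr_half_sqrt)

lemma integrable_mult_square_integrable:
  fixes f g :: "'b \<Rightarrow> real"
  assumes [measurable]: "f \<in> borel_measurable M" "g \<in> borel_measurable M"
    and "integrable M (\<lambda>x. (f x)\<^sup>2)" "integrable M (\<lambda>x. (g x)\<^sup>2)"
  shows "integrable M (\<lambda>x. f x * g x)"
proof (rule Bochner_Integration.integrable_bound)
  show "integrable M (\<lambda>x. (f x)\<^sup>2 + (g x)\<^sup>2)" using assms by auto
  have "\<bar>a * b\<bar> \<le> a\<^sup>2 + b\<^sup>2" for a b :: real
    using sum_squares_bound[of "\<bar>a\<bar>" "\<bar>b\<bar>"] abs_ge_zero[of "a * b"] unfolding abs_mult power2_abs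
    by linarith
  then show "AE x in M. norm (f x * g x) \<le> norm ((f x)\<^sup>2 + (g x)\<^sup>2)" by auto
qed measurable

lemma Cauchy_Schwarz_integral:
  fixes f g :: "'b \<Rightarrow> real"
  assumes [measurable]: "f \<in> borel_measurable M" "g \<in> borel_measurable M"
    and f: "integrable M (\<lambda>x. (f x)\<^sup>2)" and g: "integrable M (\<lambda>x. (g x)\<^sup>2)"
  shows "\<bar>\<integral>x. f x * g x \<partial>M\<bar> \<le> sqrt (\<integral>x. (f x)\<^sup>2 \<partial>M) * sqrt (\<integral>x. (g x)\<^sup>2 \<partial>M)"
proof -
  define a where "a = (\<integral>x. \<bar>f x * g x\<bar> \<partial>M)"
  have int: "integrable M (\<lambda>x. \<bar>f x * g x\<bar>)"
    using integrable_mult_square_integrable[OF assms] by auto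
  have "(\<integral>\<^sup>+x. ennreal \<bar>f x\<bar> * ennreal \<bar>g x\<bar> \<partial>M)\<^sup>2
      \<le> (\<integral>\<^sup>+x. ennreal \<bar>f x\<bar> ^ 2 \<partial>M) * (\<integral>\<^sup>+x. ennreal \<bar>g x\<bar> ^ 2 \<partial>M)"
    by (rule Cauchy_Schwarz_nn_integral) measurable
  moreover have "(\<integral>\<^sup>+x. ennreal \<bar>f x\<bar> * ennreal \<bar>g x\<bar> \<partial>M) = ennreal a"
    unfolding a_def by (subst nn_integral_eq_integral[OF int, symmetric]) (auto simp: abs_mult ennreal_mult)
  moreover have "(\<integral>\<^sup>+x. ennreal \<bar>f x\<bar> ^ 2 \<partial>M) = ennreal (\<integral>x. (f x)\<^sup>2 \<partial>M)"
    by (subst nn_integral_eq_integral[OF f, symmetric]) (auto simp: ennreal_power)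
  moreover have "(\<integral>\<^sup>+x. ennreal \<bar>g x\<bar> ^ 2 \<partial>M) = ennreal (\<integral>x. (g x)\<^sup>2 \<partial>M)"
    by (subst nn_integral_eq_integral[OF g, symmetric]) (auto simp: ennreal_power)
  ultimately have "a\<^sup>2 \<le> (\<integral>x. (f x)\<^sup>2 \<partial>M) * (\<integral>x. (g x)\<^sup>2 \<partial>M)"
    by (simp add: ennreal_power a_def flip: ennreal_mult)
  then have "a \<le> sqrt (\<integral>x. (f x)\<^sup>2 \<partial>M) * sqrt (\<integral>x. (g x)\<^sup>2 \<partial>M)"
    by (simp add: real_le_rsqrt flip: real_sqrt_mult)
  moreover have "\<bar>\<integral>x. f x * g x \<partial>M\<bar> \<le> a"
    unfolding a_def by (rule integral_abs_bound)
  ultimately show ?thesis by simp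
qed

section \<open>The logarithmic Sobolev inequality for truncations\<close>

lemma ext_integral_nonneg:
  "(\<And>x. 0 \<le> h x) \<Longrightarrow> ext_integral M h = enn2ereal (\<integral>\<^sup>+x. ennreal (h x) \<partial>M)"
  by (simp add: ext_integral_def ennreal_neg zero_ennreal.rep_eq)

lemma ext_integral_integrable:
  assumes "integrable M h"
  shows "ext_integral M h = ereal (\<integral>x. h x \<partial>M)"
proof -
  have fin: "(\<integral>\<^sup>+x. ennreal (h x) \<partial>M) \<noteq> \<infinity>" "(\<integral>\<^sup>+x. ennreal (- h x) \<partial>M) \<noteq> \<infinity>"
    using assms unfolding real_integrable_def by auto
  then have *: "enn2ereal (\<integral>\<^sup>+x. ennreal (h x) \<partial>M) = ereal (enn2real (\<integral>\<^sup>+x. ennreal (h x) \<partial>M))"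
     "enn2ereal (\<integral>\<^sup>+x. ennreal (- h x) \<partial>M) = ereal (enn2real (\<integral>\<^sup>+x. ennreal (- h x) \<partial>M))"
    by (metis enn2ereal_ennreal enn2real_nonneg ennreal_enn2real_if infinity_ennreal_def)+
  show ?thesis
    unfolding ext_integral_def real_lebesgue_integral_def[OF assms] * by simp
qed

lemma levy_kernel_nonneg: "levy_kernel J \<Longrightarrow> 0 \<le> J x y"
  by (auto simp: levy_kernel_def)

lemma levy_kernel_measurable:
  "levy_kernel J \<Longrightarrow> (\<lambda>z. J (fst z) (snd z)) \<in> borel_measurable (lborel \<Otimes>\<^sub>M lborel)"
  unfolding levy_kernel_def case_prod_beta' by blast

lemma energy_nonneg_eq:
  assumes "levy_kernel J" "\<And>x y. 0 \<le> (f x - f y) * (g x - g y)"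
  shows "energy J f g = ereal (1 / 2) *
    enn2ereal (\<integral>\<^sup>+z. ennreal ((f (fst z) - f (snd z)) * (g (fst z) - g (snd z)) * J (fst z) (snd z))
      \<partial>(lborel \<Otimes>\<^sub>M lborel))"
  unfolding energy_def case_prod_beta'
  using assms levy_kernel_nonneg[OF assms(1)]
  by (subst ext_integral_nonneg) (auto intro!: mult_nonneg_nonneg)

text \<open>The sign conditions turn both forms into integrals of nonnegative functions, so a
  pointwise comparison of the integrands suffices and infinite values do no harm.\<close>

lemma energy_mono:
  assumes J: "levy_kernel J" and c: "0 \<le> c"
    and [measurable]: "f' \<in> borel_measurable borel" "g' \<in> borel_measurable borel"
    and nn: "\<And>x y. 0 \<le> (f x - f y) * (g x - g y)" "\<And>x y. 0 \<le> (f' x - f' y) * (g' x - g' y)"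
    and le: "\<And>x y. (f x - f y) * (g x - g y) \<le> c * ((f' x - f' y) * (g' x - g' y))"
  shows "energy J f g \<le> ereal c * energy J f' g'"
proof -
  note [measurable] = levy_kernel_measurable[OF J]
  define I where "I f g = (\<integral>\<^sup>+z. ennreal ((f (fst z) - f (snd z)) * (g (fst z) - g (snd z)) * J (fst z) (snd z))
      \<partial>(lborel \<Otimes>\<^sub>M lborel))" for f g
  have "I f g \<le> (\<integral>\<^sup>+z. ennreal c * ennreal ((f' (fst z) - f' (snd z)) * (g' (fst z) - g' (snd z)) * J (fst z) (snd z))
      \<partial>(lborel \<Otimes>\<^sub>M lborel))"
    unfolding I_def
  proof (rule nn_integral_mono)
    fix z :: "'a \<times> 'a"
    have "(f (fst z) - f (snd z)) * (g (fst z) - g (snd z)) * J (fst z) (snd z)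
      \<le> c * ((f' (fst z) - f' (snd z)) * (g' (fst z) - g' (snd z))) * J (fst z) (snd z)"
      using levy_kernel_nonneg[OF J] by (intro mult_right_mono le)
    also have "\<dots> = c * ((f' (fst z) - f' (snd z)) * (g' (fst z) - g' (snd z)) * J (fst z) (snd z))"
      by simp
    finally show "ennreal ((f (fst z) - f (snd z)) * (g (fst z) - g (snd z)) * J (fst z) (snd z))
      \<le> ennreal c * ennreal ((f' (fst z) - f' (snd z)) * (g' (fst z) - g' (snd z)) * J (fst z) (snd z))"
      using c by (metis ennreal_leI ennreal_mult')
  qed
  also have "\<dots> = ennreal c * I f' g'"
    unfolding I_def by (rule nn_integral_cmult) measurable
  finally have "enn2ereal (I f g) \<le> enn2ereal (ennreal c * I f' g')"
    by (simp add: less_eq_ennreal.rep_eq)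
  also have "\<dots> = ereal c * enn2ereal (I f' g')"
    using c by (simp add: times_ennreal.rep_eq enn2ereal_ennreal)
  finally have "ereal (1 / 2) * enn2ereal (I f g) \<le> ereal (1 / 2) * (ereal c * enn2ereal (I f' g'))"
    by (intro ereal_mult_left_mono) auto
  then show ?thesis
    unfolding energy_nonneg_eq[OF J nn(1)] energy_nonneg_eq[OF J nn(2)] I_def[symmetric]
    by (simp only: mult.left_commute)
qed

text \<open>The Markov property of the form: squared increments grow by at most L^2, both between
  two points and, thanks to \<phi>(0) = 0, in the L^2 norm.\<close>

lemma lipschitz_comp_HL:
  fixes J :: "'a::euclidean_space \<Rightarrow> 'a \<Rightarrow> real"
  assumes J: "levy_kernel J" and w: "w \<in> HL J" and [measurable]: "\<phi> \<in> borel_measurable borel"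
    and lip: "\<And>a b. \<bar>\<phi> a - \<phi> b\<bar> \<le> L * \<bar>a - b\<bar>" and 0: "\<phi> 0 = 0"
  shows "(\<lambda>x. \<phi> (w x)) \<in> HL J"
proof -
  have [measurable]: "w \<in> borel_measurable borel" and w2: "integrable lborel (\<lambda>x. (w x)\<^sup>2)"
    and E: "energy J w w < \<infinity>"
    using w by (auto simp: HL_def memLp_2_iff)
  have sq: "(\<phi> a - \<phi> b)\<^sup>2 \<le> L\<^sup>2 * (a - b)\<^sup>2" for a b
    using power_mono[OF lip[of a b], of 2] by (simp add: power_mult_distrib)
  have "integrable lborel (\<lambda>x. (\<phi> (w x))\<^sup>2)"
  proof (rule Bochner_Integration.integrable_bound)
    show "integrable lborel (\<lambda>x. L\<^sup>2 * (w x)\<^sup>2)" using w2 by simp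
    show "AE x in lborel. norm ((\<phi> (w x))\<^sup>2) \<le> norm (L\<^sup>2 * (w x)\<^sup>2)"
      using sq[of _ 0] 0 by auto
  qed measurable
  moreover have "energy J (\<lambda>x. \<phi> (w x)) (\<lambda>x. \<phi> (w x)) \<le> ereal (L\<^sup>2) * energy J w w"
    using sq by (intro energy_mono[OF J]) (auto simp flip: power2_eq_square)
  moreover have "ereal (L\<^sup>2) * energy J w w < \<infinity>"
    using E by (cases "energy J w w") auto
  ultimately show ?thesis
    by (auto simp: HL_def memLp_2_iff)
qed

text \<open>This makes |f|^(r-2) f, for the truncation f of w, an admissible test function in the
  weak equation.\<close>

lemma tpow_comp_HL:
  assumes "levy_kernel J" "w \<in> HL J" "0 < k" "2 \<le> r"
  shows "(\<lambda>x. tpow k r (w x)) \<in> HL J"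
  by (rule lipschitz_comp_HL[OF assms(1,2) tpow_measurable tpow_mono_lipschitz(3)]) (use assms in auto)

text \<open>Admissibility of the truncation in the logarithmic Sobolev inequality. As r / 2 \<ge> 1,
  the power is Lipschitz on [0,k].\<close>

lemma trunc_powr_comp_HL:
  assumes "levy_kernel J" "w \<in> HL J" "0 < k" "2 \<le> r"
  shows "(\<lambda>x. \<bar>trunc k (w x)\<bar> powr (r / 2)) \<in> HL J"
proof (rule lipschitz_comp_HL[OF assms(1,2)])
  fix a b
  have "\<bar>\<bar>trunc k a\<bar> powr (r / 2) - \<bar>trunc k b\<bar> powr (r / 2)\<bar>
     \<le> r / 2 * k powr (r / 2 - 1) * \<bar>\<bar>trunc k a\<bar> - \<bar>trunc k b\<bar>\<bar>"
    using assms by (intro powr_lipschitz_on_interval) (auto simp: abs_trunc)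
  also have "\<dots> \<le> r / 2 * k powr (r / 2 - 1) * \<bar>a - b\<bar>"
    using assms by (intro mult_left_mono) (auto simp: abs_trunc)
  finally show "\<bar>\<bar>trunc k a\<bar> powr (r / 2) - \<bar>trunc k b\<bar> powr (r / 2)\<bar>
     \<le> r / 2 * k powr (r / 2 - 1) * \<bar>a - b\<bar>" .
qed (use assms in \<open>auto simp: trunc_def\<close>)

lemma integrable_Phi_trunc:
  assumes [measurable]: "w \<in> borel_measurable M" and w2: "integrable M (\<lambda>x. (w x)\<^sup>2)"
    and r: "2 < r" and \<kappa>: "0 \<le> \<kappa>"
  shows "integrable M (\<lambda>x. Phi (min \<bar>w x\<bar> (exp \<kappa>) powr r))"
proof (rule Bochner_Integration.integrable_bound)
  show "integrable M (\<lambda>x. r * (1 / (r - 2) + \<kappa> * exp (r * \<kappa>)) * (w x)\<^sup>2)" using w2 by simp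
  show "AE x in M. norm (Phi (min \<bar>w x\<bar> (exp \<kappa>) powr r)) \<le>
      norm (r * (1 / (r - 2) + \<kappa> * exp (r * \<kappa>)) * (w x)\<^sup>2)"
  proof (rule AE_I2)
    fix x
    have "(min \<bar>w x\<bar> (exp \<kappa>))\<^sup>2 \<le> (w x)\<^sup>2"
      by (subst power2_abs[of "w x", symmetric], rule power_mono) auto
    then have "r * (1 / (r - 2) + \<kappa> * exp (r * \<kappa>)) * (min \<bar>w x\<bar> (exp \<kappa>))\<^sup>2
        \<le> r * (1 / (r - 2) + \<kappa> * exp (r * \<kappa>)) * (w x)\<^sup>2"
      using r \<kappa> by (intro mult_left_mono) auto
    then show "norm (Phi (min \<bar>w x\<bar> (exp \<kappa>) powr r)) \<le>
      norm (r * (1 / (r - 2) + \<kappa> * exp (r * \<kappa>)) * (w x)\<^sup>2)"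
      using Phi_powr_bound[OF r \<kappa>, of "min \<bar>w x\<bar> (exp \<kappa>)"] by simp
  qed
qed (simp add: Phi_def)

text \<open>
  The energy is paired with \<open>w\<close> itself and not with its truncation: this is the quantity which
  the equation produces, and truncation does not increase it.
\<close>

lemma log_sobolev_trunc:
  fixes J :: "'a::euclidean_space \<Rightarrow> 'a \<Rightarrow> real"
  assumes J: "levy_kernel J" and LS: "log_sobolev J r c d" and d: "0 < d"
    and r: "2 < r" and \<kappa>: "0 \<le> \<kappa>" and w: "w \<in> HL J"
    and E: "energy J w (\<lambda>x. tpow (exp \<kappa>) r (w x)) = ereal e"
  defines "M \<equiv> \<integral>x. min \<bar>w x\<bar> (exp \<kappa>) powr r \<partial>lborel"
  shows "(\<integral>x. Phi (min \<bar>w x\<bar> (exp \<kappa>) powr r) \<partial>lborel) - Phi M \<le> c * M + d * e"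
proof -
  define k where "k = exp \<kappa>"
  have k: "0 < k" by (simp add: k_def)
  have [measurable]: "w \<in> borel_measurable borel" and w2: "integrable lborel (\<lambda>x. (w x)\<^sup>2)"
    using w by (auto simp: HL_def memLp_2_iff)
  define f where "f = (\<lambda>x. trunc k (w x))"
  have absf: "\<bar>f x\<bar> = min \<bar>w x\<bar> k" for x
    using k by (simp add: f_def abs_trunc)
  have "f \<in> borel_measurable lborel" unfolding f_def by measurable
  moreover have "(\<lambda>x. \<bar>f x\<bar> powr (r / 2)) \<in> HL J"
    unfolding f_def using r k by (intro trunc_powr_comp_HL J w) auto
  ultimately have "Ent (\<lambda>x. \<bar>f x\<bar> powr r) \<le>
      ereal (c * lpnorm r f powr r) + ereal d * energy J (\<lambda>x. \<bar>f x\<bar> powr (r - 2) * f x) f"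
    using LS unfolding log_sobolev_def by blast
  moreover have "lpnorm r f powr r = M"
    using r by (simp add: lpnorm_def absf powr_powr M_def k_def)
  moreover have "Ent (\<lambda>x. \<bar>f x\<bar> powr r) = ereal ((\<integral>x. Phi (min \<bar>w x\<bar> k powr r) \<partial>lborel) - Phi M)"
    using integrable_Phi_trunc[OF _ w2 r \<kappa>]
    by (simp add: Ent_def absf ext_integral_integrable k_def M_def)
  moreover have "energy J (\<lambda>x. \<bar>f x\<bar> powr (r - 2) * f x) f \<le> ereal 1 * energy J w (\<lambda>x. tpow k r (w x))"
  proof (rule energy_mono[OF J])
    fix x y
    have eq: "(\<lambda>x. \<bar>f x\<bar> powr (r - 2) * f x) = (\<lambda>x. tpow k r (w x))"
      by (simp add: f_def tpow_def)
    show "0 \<le> (\<bar>f x\<bar> powr (r - 2) * f x - \<bar>f y\<bar> powr (r - 2) * f y) * (f x - f y)"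
      using tpow_mono_lipschitz(1)[of k r "w x" "w y"] k r by (simp add: f_def tpow_def)
    show "0 \<le> (w x - w y) * (tpow k r (w x) - tpow k r (w y))"
      using tpow_mono_lipschitz(1,2)[of k r "w x" "w y"] k r by (simp add: mult.commute)
    show "(\<bar>f x\<bar> powr (r - 2) * f x - \<bar>f y\<bar> powr (r - 2) * f y) * (f x - f y)
      \<le> 1 * ((w x - w y) * (tpow k r (w x) - tpow k r (w y)))"
      using tpow_mono_lipschitz(2)[of k r "w x" "w y"] k r by (simp add: f_def tpow_def mult.commute)
  qed auto
  then have "ereal d * energy J (\<lambda>x. \<bar>f x\<bar> powr (r - 2) * f x) f \<le> ereal d * ereal e"
    using d E by (intro ereal_mult_left_mono) (auto simp: k_def)
  ultimately have "ereal ((\<integral>x. Phi (min \<bar>w x\<bar> k powr r) \<partial>lborel) - Phi M) \<le> ereal (c * M) + ereal d * ereal e"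
    by (metis add_left_mono order_trans)
  then show ?thesis by (simp add: k_def)
qed

section \<open>The truncated norm along a path in square-integrable functions\<close>

text \<open>A crude majorant of the quadratic constant of \<open>lin_powr\<close>, the same for all
  exponents up to R and all levels up to exp K.\<close>

lemma lin_powr_coeff_le:
  fixes r R \<kappa> K :: real
  assumes "2 \<le> r" "r \<le> R" "0 \<le> \<kappa>" "\<kappa> \<le> K"
  shows "r * ((r - 1) * exp \<kappa> powr (r - 2)) \<le> R * (R * exp (R * K))"
proof -
  have "(r - 2) * \<kappa> \<le> R * K" using assms by (intro mult_mono) auto
  then show ?thesis
    using assms by (intro mult_mono) (auto simp: powr_def)
qed

lemma tendsto_lin_powr_param:
  assumes "(\<kappa> \<longlongrightarrow> k0) F" "(q \<longlongrightarrow> r) F" "2 \<le> r"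
  shows "((\<lambda>\<tau>. lin_powr (exp (\<kappa> \<tau>)) (q \<tau>) s) \<longlongrightarrow> lin_powr (exp k0) r s) F"
proof (cases "s = 0")
  case False
  then show ?thesis
    unfolding lin_powr_def excess_def
    by (intro tendsto_intros assms) (auto simp: min_def)
qed (simp add: lin_powr_def excess_def)

lemma tendsto_tpow_param:
  assumes \<kappa>: "(\<kappa> \<longlongrightarrow> k0) F" and q: "(q \<longlongrightarrow> r) F" "2 \<le> r" "\<forall>\<^sub>F \<tau> in F. 2 \<le> q \<tau>"
  shows "((\<lambda>\<tau>. tpow (exp (\<kappa> \<tau>)) (q \<tau>) s) \<longlongrightarrow> tpow (exp k0) r s) F"
proof (cases "s = 0")
  case False
  have "((\<lambda>\<tau>. sgn s * min \<bar>s\<bar> (exp (\<kappa> \<tau>)) powr (q \<tau> - 1)) \<longlongrightarrow> sgn s * min \<bar>s\<bar> (exp k0) powr (r - 1)) F"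
    using False by (intro tendsto_intros \<kappa> q) (auto simp: min_def)
  moreover have "\<forall>\<^sub>F \<tau> in F. sgn s * min \<bar>s\<bar> (exp (\<kappa> \<tau>)) powr (q \<tau> - 1) = tpow (exp (\<kappa> \<tau>)) (q \<tau>) s"
    using q(3) by eventually_elim (simp add: tpow_eq)
  ultimately show ?thesis
    using q(2) by (simp add: tpow_eq tendsto_cong)
qed simp

lemma integrable_lin_powr:
  assumes [measurable]: "w \<in> borel_measurable M" and w2: "integrable M (\<lambda>x. (w x)\<^sup>2)"
    and k: "0 < k" and r: "2 \<le> r"
  shows "integrable M (\<lambda>x. lin_powr k r (w x))"
proof (rule Bochner_Integration.integrable_bound)
  show "integrable M (\<lambda>x. r * ((r - 1) * k powr (r - 2)) * (w x)\<^sup>2)" using w2 by simp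
  show "AE x in M. norm (lin_powr k r (w x)) \<le> norm (r * ((r - 1) * k powr (r - 2)) * (w x)\<^sup>2)"
    using lin_powr_le_square[OF k r] lin_powr_nonneg[OF k, of r] r
    by (auto intro!: order.trans[OF _ abs_ge_self])
qed measurable

text \<open>The two variations are separated. With the function fixed at w, dominated convergence
  handles the parameters. With the parameters fixed, the Taylor bound at w and Cauchy-Schwarz
  control the change by |u - w|_2, so L^2 convergence of the functions suffices.\<close>

lemma tendsto_integral_lin_powr:
  fixes u :: "nat \<Rightarrow> 'b \<Rightarrow> real"
  assumes [measurable]: "\<And>n. u n \<in> borel_measurable M" "w \<in> borel_measurable M"
    and u2: "\<And>n. integrable M (\<lambda>x. (u n x)\<^sup>2)" and w2: "integrable M (\<lambda>x. (w x)\<^sup>2)"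
    and lim: "(\<lambda>n. \<integral>x. (u n x - w x)\<^sup>2 \<partial>M) \<longlonglongrightarrow> 0"
    and \<kappa>: "\<kappa> \<longlonglongrightarrow> k0" "\<And>n. 0 \<le> \<kappa> n" "\<And>n. \<kappa> n \<le> K"
    and q: "q \<longlonglongrightarrow> r" "\<And>n. 2 \<le> q n" "\<And>n. q n \<le> R" "2 \<le> r"
  shows "(\<lambda>n. \<integral>x. lin_powr (exp (\<kappa> n)) (q n) (u n x) \<partial>M) \<longlonglongrightarrow> (\<integral>x. lin_powr (exp k0) r (w x) \<partial>M)"
proof -
  define B where "B = R * (R * exp (R * K))"
  have "2 \<le> R" using q by (meson order_trans)
  then have B0: "0 \<le> B" by (simp add: B_def)
  have coeff: "q n * ((q n - 1) * exp (\<kappa> n) powr (q n - 2)) \<le> B" for n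
    unfolding B_def by (intro lin_powr_coeff_le q \<kappa>)
  have d2: "integrable M (\<lambda>x. (u n x - w x)\<^sup>2)" for n
  proof (rule Bochner_Integration.integrable_bound)
    show "integrable M (\<lambda>x. 2 * (u n x)\<^sup>2 + 2 * (w x)\<^sup>2)" using u2 w2 by simp
    have "(a - b)\<^sup>2 \<le> 2 * a\<^sup>2 + 2 * b\<^sup>2" for a b :: real
      using zero_le_power2[of "a + b"] by (simp add: power2_eq_square algebra_simps)
    then show "AE x in M. norm ((u n x - w x)\<^sup>2) \<le> norm (2 * (u n x)\<^sup>2 + 2 * (w x)\<^sup>2)" by simp
  qed measurable
  have wd: "integrable M (\<lambda>x. \<bar>w x\<bar> * \<bar>u n x - w x\<bar>)" for n
    by (rule integrable_mult_square_integrable) (use w2 d2 in auto)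
  define S where "S n = (\<integral>x. lin_powr (exp (\<kappa> n)) (q n) (w x) \<partial>M)" for n
  have S: "S \<longlonglongrightarrow> (\<integral>x. lin_powr (exp k0) r (w x) \<partial>M)"
    unfolding S_def
  proof (rule integral_dominated_convergence[where w = "\<lambda>x. B * (w x)\<^sup>2"])
    show "AE x in M. (\<lambda>n. lin_powr (exp (\<kappa> n)) (q n) (w x)) \<longlonglongrightarrow> lin_powr (exp k0) r (w x)"
      by (intro AE_I2 tendsto_lin_powr_param \<kappa> q)
    fix n
    show "AE x in M. norm (lin_powr (exp (\<kappa> n)) (q n) (w x)) \<le> B * (w x)\<^sup>2"
    proof (rule AE_I2)
      fix x
      have "lin_powr (exp (\<kappa> n)) (q n) (w x) \<le> q n * ((q n - 1) * exp (\<kappa> n) powr (q n - 2)) * (w x)\<^sup>2"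
        by (intro lin_powr_le_square q) auto
      also have "\<dots> \<le> B * (w x)\<^sup>2" by (intro mult_right_mono coeff) auto
      finally show "norm (lin_powr (exp (\<kappa> n)) (q n) (w x)) \<le> B * (w x)\<^sup>2"
        using lin_powr_nonneg[of "exp (\<kappa> n)" "q n" "w x"] q(2)[of n] by simp
    qed
  qed (use w2 in auto)
  have diff: "\<bar>(\<integral>x. lin_powr (exp (\<kappa> n)) (q n) (u n x) \<partial>M) - S n\<bar>
      \<le> B * (sqrt (\<integral>x. (w x)\<^sup>2 \<partial>M) * sqrt (\<integral>x. (u n x - w x)\<^sup>2 \<partial>M)) + B * (\<integral>x. (u n x - w x)\<^sup>2 \<partial>M)" for n
  proof -
    have iu: "integrable M (\<lambda>x. lin_powr (exp (\<kappa> n)) (q n) (u n x))"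
      and iw: "integrable M (\<lambda>x. lin_powr (exp (\<kappa> n)) (q n) (w x))"
      using u2 w2 q by (auto intro!: integrable_lin_powr)
    have pt: "\<bar>lin_powr (exp (\<kappa> n)) (q n) (u n x) - lin_powr (exp (\<kappa> n)) (q n) (w x)\<bar>
       \<le> B * (\<bar>w x\<bar> * \<bar>u n x - w x\<bar>) + B * (u n x - w x)\<^sup>2" for x
    proof -
      let ?L = "(q n - 1) * exp (\<kappa> n) powr (q n - 2)"
      have "\<bar>q n * tpow (exp (\<kappa> n)) (q n) (w x) * (u n x - w x)\<bar> \<le> (q n * ?L) * (\<bar>w x\<bar> * \<bar>u n x - w x\<bar>)"
      proof -
        have "\<bar>tpow (exp (\<kappa> n)) (q n) (w x)\<bar> \<le> ?L * \<bar>w x\<bar>"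
          by (intro abs_tpow_le q) auto
        then have "q n * \<bar>tpow (exp (\<kappa> n)) (q n) (w x)\<bar> * \<bar>u n x - w x\<bar> \<le> q n * (?L * \<bar>w x\<bar>) * \<bar>u n x - w x\<bar>"
          using q(2)[of n] by (intro mult_right_mono mult_left_mono) auto
        then show ?thesis
          using q(2)[of n] by (simp only: abs_mult mult.assoc)
      qed
      also have "\<dots> \<le> B * (\<bar>w x\<bar> * \<bar>u n x - w x\<bar>)"
        by (intro mult_right_mono coeff) auto
      finally have 1: "\<bar>q n * tpow (exp (\<kappa> n)) (q n) (w x) * (u n x - w x)\<bar> \<le> B * (\<bar>w x\<bar> * \<bar>u n x - w x\<bar>)" .
      have "\<bar>lin_powr (exp (\<kappa> n)) (q n) (u n x) - lin_powr (exp (\<kappa> n)) (q n) (w x)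
         - q n * tpow (exp (\<kappa> n)) (q n) (w x) * (u n x - w x)\<bar> \<le> q n * ?L * (u n x - w x)\<^sup>2"
        by (intro lin_powr_taylor q) auto
      also have "\<dots> \<le> B * (u n x - w x)\<^sup>2" by (intro mult_right_mono coeff) auto
      finally show ?thesis using 1 by linarith
    qed
    have "\<bar>(\<integral>x. lin_powr (exp (\<kappa> n)) (q n) (u n x) \<partial>M) - S n\<bar>
       = \<bar>\<integral>x. lin_powr (exp (\<kappa> n)) (q n) (u n x) - lin_powr (exp (\<kappa> n)) (q n) (w x) \<partial>M\<bar>"
      unfolding S_def by (simp add: iu iw)
    also have "\<dots> \<le> (\<integral>x. B * (\<bar>w x\<bar> * \<bar>u n x - w x\<bar>) + B * (u n x - w x)\<^sup>2 \<partial>M)"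
      using pt iu iw wd[of n] d2[of n]
      by (intro order.trans[OF integral_abs_bound] integral_mono) (auto intro!: Bochner_Integration.integrable_add integrable_mult_right)
    also have "\<dots> = B * (\<integral>x. \<bar>w x\<bar> * \<bar>u n x - w x\<bar> \<partial>M) + B * (\<integral>x. (u n x - w x)\<^sup>2 \<partial>M)"
      using wd[of n] d2[of n] by simp
    also have "(\<integral>x. \<bar>w x\<bar> * \<bar>u n x - w x\<bar> \<partial>M) \<le> sqrt (\<integral>x. (w x)\<^sup>2 \<partial>M) * sqrt (\<integral>x. (u n x - w x)\<^sup>2 \<partial>M)"
      using Cauchy_Schwarz_integral[of "\<lambda>x. \<bar>w x\<bar>" M "\<lambda>x. \<bar>u n x - w x\<bar>"] w2 d2[of n] by simp
    finally show ?thesis using B0 by (simp add: mult_left_mono)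
  qed
  have "(\<lambda>n. B * (sqrt (\<integral>x. (w x)\<^sup>2 \<partial>M) * sqrt (\<integral>x. (u n x - w x)\<^sup>2 \<partial>M)) + B * (\<integral>x. (u n x - w x)\<^sup>2 \<partial>M))
     \<longlonglongrightarrow> B * (sqrt (\<integral>x. (w x)\<^sup>2 \<partial>M) * sqrt 0) + B * 0"
    by (intro tendsto_intros lim)
  then have "(\<lambda>n. B * (sqrt (\<integral>x. (w x)\<^sup>2 \<partial>M) * sqrt (\<integral>x. (u n x - w x)\<^sup>2 \<partial>M)) + B * (\<integral>x. (u n x - w x)\<^sup>2 \<partial>M))
     \<longlonglongrightarrow> 0"
    by simp
  then have "(\<lambda>n. (\<integral>x. lin_powr (exp (\<kappa> n)) (q n) (u n x) \<partial>M) - S n) \<longlonglongrightarrow> 0"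
    by (rule Lim_null_comparison[rotated]) (simp add: diff)
  from tendsto_add[OF this S] show ?thesis by simp
qed

text \<open>Since u is differentiable in L^2 and not pointwise in x, differentiation under the
  integral is applied only to the parameters, at the fixed function u t. The change of the function
  is linearized with slope \<open>q * tpow\<close> at the moved parameters; the quadratic remainder,
  divided by the time step, vanishes. The lower bound \<open>r0\<close> above 2 makes the domination
  uniform near t.\<close>

lemma has_real_derivative_integral_lin_powr:
  fixes u :: "real \<Rightarrow> 'b \<Rightarrow> real" and \<kappa> q \<kappa>' q' :: "real \<Rightarrow> real"
  assumes \<delta>: "0 < \<delta>"
    and um: "\<And>\<tau>. \<tau> \<in> ball t \<delta> \<Longrightarrow> u \<tau> \<in> borel_measurable M"
    and u2: "\<And>\<tau>. \<tau> \<in> ball t \<delta> \<Longrightarrow> integrable M (\<lambda>x. (u \<tau> x)\<^sup>2)"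
    and vm [measurable]: "v \<in> borel_measurable M" and v2: "integrable M (\<lambda>x. (v x)\<^sup>2)"
    and du: "((\<lambda>h. \<integral>x. ((u (t + h) x - u t x) / h - v x)\<^sup>2 \<partial>M) \<longlongrightarrow> 0) (at 0)"
    and \<kappa>: "\<And>\<tau>. \<tau> \<in> ball t \<delta> \<Longrightarrow> (\<kappa> has_real_derivative \<kappa>' \<tau>) (at \<tau>)"
    and q: "\<And>\<tau>. \<tau> \<in> ball t \<delta> \<Longrightarrow> (q has_real_derivative q' \<tau>) (at \<tau>)"
    and r0: "2 < r0" "\<And>\<tau>. \<tau> \<in> ball t \<delta> \<Longrightarrow> r0 \<le> q \<tau>"
    and bnd: "\<And>\<tau>. \<tau> \<in> ball t \<delta> \<Longrightarrow> q \<tau> \<le> R" "\<And>\<tau>. \<tau> \<in> ball t \<delta> \<Longrightarrow> 0 \<le> \<kappa> \<tau>"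
      "\<And>\<tau>. \<tau> \<in> ball t \<delta> \<Longrightarrow> \<kappa> \<tau> \<le> K"
      "\<And>\<tau>. \<tau> \<in> ball t \<delta> \<Longrightarrow> \<bar>q' \<tau>\<bar> \<le> Q" "\<And>\<tau>. \<tau> \<in> ball t \<delta> \<Longrightarrow> \<bar>\<kappa>' \<tau>\<bar> \<le> Q"
  shows "((\<lambda>\<tau>. \<integral>x. lin_powr (exp (\<kappa> \<tau>)) (q \<tau>) (u \<tau> x) \<partial>M) has_real_derivative
      (\<integral>x. lin_powr_dt (\<kappa> t) (\<kappa>' t) (q t) (q' t) (u t x) \<partial>M)
       + (\<integral>x. q t * tpow (exp (\<kappa> t)) (q t) (u t x) * v x \<partial>M)) (at t)"
proof -
  define w where "w = u t"
  have t: "t \<in> ball t \<delta>" using \<delta> by simp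
  have wm [measurable]: "w \<in> borel_measurable M" and w2: "integrable M (\<lambda>x. (w x)\<^sup>2)"
    using um[OF t] u2[OF t] by (auto simp: w_def)
  define B where "B = R * (R * exp (R * K))"
  define C where "C = Q * (R * (1 / (r0 - 2) + K * exp (R * K)) + (1 + R * K) * (R * (R * exp (R * K))))
       + R * Q * (R * (R * exp (R * K)))"
  have "2 \<le> R" using r0(1) r0(2)[OF t] bnd(1)[OF t] by linarith
  then have B0: "0 \<le> B" by (simp add: B_def)
  have q2: "2 \<le> q \<tau>" if "\<tau> \<in> ball t \<delta>" for \<tau>
    using r0(1) r0(2)[OF that] by simp
  have coeff: "q \<tau> * ((q \<tau> - 1) * exp (\<kappa> \<tau>) powr (q \<tau> - 2)) \<le> B" if "\<tau> \<in> ball t \<delta>" for \<tau>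
    unfolding B_def using that by (intro lin_powr_coeff_le q2 bnd)
  have abs_qtpow: "\<bar>q \<tau> * tpow (exp (\<kappa> \<tau>)) (q \<tau>) s\<bar> \<le> B * \<bar>s\<bar>" if "\<tau> \<in> ball t \<delta>" for \<tau> s
  proof -
    have "\<bar>q \<tau> * tpow (exp (\<kappa> \<tau>)) (q \<tau>) s\<bar> \<le> (q \<tau> * ((q \<tau> - 1) * exp (\<kappa> \<tau>) powr (q \<tau> - 2))) * \<bar>s\<bar>"
    proof -
      have "\<bar>tpow (exp (\<kappa> \<tau>)) (q \<tau>) s\<bar> \<le> (q \<tau> - 1) * exp (\<kappa> \<tau>) powr (q \<tau> - 2) * \<bar>s\<bar>"
        using q2[OF that] by (intro abs_tpow_le) auto
      then have "q \<tau> * \<bar>tpow (exp (\<kappa> \<tau>)) (q \<tau>) s\<bar> \<le> q \<tau> * ((q \<tau> - 1) * exp (\<kappa> \<tau>) powr (q \<tau> - 2) * \<bar>s\<bar>)"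
        using q2[OF that] by (intro mult_left_mono) auto
      then show ?thesis
        using q2[OF that] by (simp only: abs_mult mult.assoc)
    qed
    also have "\<dots> \<le> B * \<bar>s\<bar>" using that by (intro mult_right_mono coeff) auto
    finally show ?thesis .
  qed
  define F where "F \<tau> = (\<integral>x. lin_powr (exp (\<kappa> \<tau>)) (q \<tau>) (u \<tau> x) \<partial>M)" for \<tau>
  define D where "D = (\<integral>x. lin_powr_dt (\<kappa> t) (\<kappa>' t) (q t) (q' t) (w x) \<partial>M)
       + (\<integral>x. q t * tpow (exp (\<kappa> t)) (q t) (w x) * v x \<partial>M)"
  \<comment> \<open>Difference quotients are followed along sequences, the setting of dominated
    convergence.\<close>
  have key: "(\<lambda>n. (F (t + Y n) - F t) / Y n) \<longlonglongrightarrow> D"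
    if Y: "Y \<longlonglongrightarrow> 0" "\<And>n. Y n \<noteq> 0" "\<And>n. t + Y n \<in> ball t \<delta>" for Y :: "nat \<Rightarrow> real"
  proof -
    have tY: "(\<lambda>n. t + Y n) \<longlonglongrightarrow> t" using tendsto_add[OF tendsto_const Y(1)] by simp
    have kY: "(\<lambda>n. \<kappa> (t + Y n)) \<longlonglongrightarrow> \<kappa> t" and qY: "(\<lambda>n. q (t + Y n)) \<longlonglongrightarrow> q t"
      using isCont_tendsto_compose[OF DERIV_isCont[OF \<kappa>[OF t]] tY]
        isCont_tendsto_compose[OF DERIV_isCont[OF q[OF t]] tY] by auto
    define U where "U n = u (t + Y n)" for n
    have [measurable]: "U n \<in> borel_measurable M" and U2: "integrable M (\<lambda>x. (U n x)\<^sup>2)" for n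
      using um u2 Y(3) by (auto simp: U_def)
    define d where "d n x = (U n x - w x) / Y n - v x" for n x
    have [measurable]: "d n \<in> borel_measurable M" for n unfolding d_def by measurable
    have d2: "integrable M (\<lambda>x. (d n x)\<^sup>2)" for n
    proof (rule Bochner_Integration.integrable_bound)
      show "integrable M (\<lambda>x. 3 * (U n x)\<^sup>2 / (Y n)\<^sup>2 + 3 * (w x)\<^sup>2 / (Y n)\<^sup>2 + 3 * (v x)\<^sup>2)"
        using U2 w2 v2 by auto
      have "(a - b - c)\<^sup>2 \<le> 3 * a\<^sup>2 + 3 * b\<^sup>2 + 3 * c\<^sup>2" for a b c :: real
        using zero_le_power2[of "a + b"] zero_le_power2[of "a + c"] zero_le_power2[of "b - c"]
        by (simp add: power2_eq_square algebra_simps)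
      from this[of "U n _ / Y n" "w _ / Y n"]
      show "AE x in M. norm ((d n x)\<^sup>2) \<le> norm (3 * (U n x)\<^sup>2 / (Y n)\<^sup>2 + 3 * (w x)\<^sup>2 / (Y n)\<^sup>2 + 3 * (v x)\<^sup>2)"
        by (intro AE_I2) (simp add: d_def diff_divide_distrib power_divide)
    qed measurable
    define \<epsilon> where "\<epsilon> n = (\<integral>x. (d n x)\<^sup>2 \<partial>M)" for n
    have \<epsilon>: "\<epsilon> \<longlonglongrightarrow> 0"
      using du Y(1,2) unfolding tendsto_at_iff_sequentially \<epsilon>_def d_def U_def w_def comp_def by auto
    have wd: "integrable M (\<lambda>x. \<bar>w x\<bar> * \<bar>d n x\<bar>)" for n
      by (rule integrable_mult_square_integrable) (use w2 d2 in auto)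
    have wv: "integrable M (\<lambda>x. \<bar>w x\<bar> * \<bar>v x\<bar>)"
      by (rule integrable_mult_square_integrable) (use w2 v2 in auto)
    define \<psi> where "\<psi> n s = lin_powr (exp (\<kappa> (t + Y n))) (q (t + Y n)) s" for n s
    define g where "g n s = q (t + Y n) * tpow (exp (\<kappa> (t + Y n))) (q (t + Y n)) s" for n s
    have [measurable]: "\<psi> n \<in> borel_measurable borel" "g n \<in> borel_measurable borel" for n
      unfolding \<psi>_def g_def by measurable
    have gb: "\<bar>g n s\<bar> \<le> B * \<bar>s\<bar>" for n s
      unfolding g_def by (rule abs_qtpow[OF Y(3)])
    have gv: "integrable M (\<lambda>x. g n (w x) * v x)" for n
    proof (rule Bochner_Integration.integrable_bound)
      show "integrable M (\<lambda>x. B * (\<bar>w x\<bar> * \<bar>v x\<bar>))" using wv by simp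
      show "AE x in M. norm (g n (w x) * v x) \<le> norm (B * (\<bar>w x\<bar> * \<bar>v x\<bar>))"
        using gb B0 by (intro AE_I2) (simp add: abs_mult mult_right_mono flip: mult.assoc)
    qed measurable
    have i\<psi>: "integrable M (\<lambda>x. \<psi> n (U n x))" "integrable M (\<lambda>x. \<psi> n (w x))" for n
      unfolding \<psi>_def using U2 w2 q2[OF Y(3)] by (auto intro!: integrable_lin_powr)
    have i0: "integrable M (\<lambda>x. lin_powr (exp (\<kappa> t)) (q t) (w x))"
      using w2 q2[OF t] by (auto intro!: integrable_lin_powr)

    \<comment> \<open>The error of linearizing in the function. It has two sources:
      \<open>d n\<close>, which tends to 0 in L^2 and is paired with w by Cauchy-Schwarz, and the
      Taylor remainder, of order |Y n| after division.\<close>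
    define E where "E n = (\<integral>x. (\<psi> n (U n x) - \<psi> n (w x)) / Y n - g n (w x) * v x \<partial>M)" for n
    have "\<bar>E n\<bar> \<le> B * (sqrt (\<integral>x. (w x)\<^sup>2 \<partial>M) * sqrt (\<epsilon> n)) + B * \<bar>Y n\<bar> * (2 * \<epsilon> n + 2 * (\<integral>x. (v x)\<^sup>2 \<partial>M))" for n
    proof -
      have pt: "\<bar>(\<psi> n (U n x) - \<psi> n (w x)) / Y n - g n (w x) * v x\<bar>
          \<le> B * (\<bar>w x\<bar> * \<bar>d n x\<bar>) + B * \<bar>Y n\<bar> * (2 * (d n x)\<^sup>2 + 2 * (v x)\<^sup>2)" for x
      proof -
        have Ud: "U n x - w x = Y n * (d n x + v x)"
          using Y(2) by (simp add: d_def)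
        have "\<bar>\<psi> n (U n x) - \<psi> n (w x) - g n (w x) * (U n x - w x)\<bar>
            \<le> q (t + Y n) * ((q (t + Y n) - 1) * exp (\<kappa> (t + Y n)) powr (q (t + Y n) - 2)) * (U n x - w x)\<^sup>2"
          unfolding \<psi>_def g_def by (intro lin_powr_taylor q2 Y) auto
        also have "\<dots> \<le> B * (U n x - w x)\<^sup>2" by (intro mult_right_mono coeff Y) auto
        also have "\<dots> \<le> B * ((Y n)\<^sup>2 * (2 * (d n x)\<^sup>2 + 2 * (v x)\<^sup>2))"
          unfolding Ud power_mult_distrib using B0 zero_le_power2[of "d n x - v x"]
          by (intro mult_left_mono) (auto simp: power2_eq_square algebra_simps)
        finally have "\<bar>\<psi> n (U n x) - \<psi> n (w x) - g n (w x) * (U n x - w x)\<bar> / \<bar>Y n\<bar>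
            \<le> B * ((Y n)\<^sup>2 * (2 * (d n x)\<^sup>2 + 2 * (v x)\<^sup>2)) / \<bar>Y n\<bar>"
          by (rule divide_right_mono) auto
        also have "B * ((Y n)\<^sup>2 * (2 * (d n x)\<^sup>2 + 2 * (v x)\<^sup>2)) / \<bar>Y n\<bar>
            = B * \<bar>Y n\<bar> * (2 * (d n x)\<^sup>2 + 2 * (v x)\<^sup>2)"
        proof -
          have "(Y n)\<^sup>2 = \<bar>Y n\<bar> * \<bar>Y n\<bar>" by (simp add: power2_eq_square)
          then show ?thesis using Y(2)[of n] by (simp del: abs_mult_self_eq)
        qed
        also have "\<bar>\<psi> n (U n x) - \<psi> n (w x) - g n (w x) * (U n x - w x)\<bar> / \<bar>Y n\<bar>
            = \<bar>(\<psi> n (U n x) - \<psi> n (w x)) / Y n - g n (w x) * (d n x + v x)\<bar>"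
          using Y(2)[of n] unfolding Ud by (simp add: diff_divide_distrib flip: abs_divide)
        finally have 1: "\<bar>(\<psi> n (U n x) - \<psi> n (w x)) / Y n - g n (w x) * (d n x + v x)\<bar>
            \<le> B * \<bar>Y n\<bar> * (2 * (d n x)\<^sup>2 + 2 * (v x)\<^sup>2)" .
        have "\<bar>g n (w x) * d n x\<bar> \<le> B * (\<bar>w x\<bar> * \<bar>d n x\<bar>)"
          using gb by (simp add: abs_mult mult_right_mono flip: mult.assoc)
        then show ?thesis using 1 unfolding distrib_left by linarith
      qed
      have "\<bar>E n\<bar> \<le> (\<integral>x. B * (\<bar>w x\<bar> * \<bar>d n x\<bar>) + B * \<bar>Y n\<bar> * (2 * (d n x)\<^sup>2 + 2 * (v x)\<^sup>2) \<partial>M)"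
        unfolding E_def using pt i\<psi>[of n] gv[of n] wd[of n] d2[of n] v2
        by (intro order.trans[OF integral_abs_bound] integral_mono)
          (auto intro!: Bochner_Integration.integrable_add Bochner_Integration.integrable_diff integrable_mult_right)
      also have "\<dots> = B * (\<integral>x. \<bar>w x\<bar> * \<bar>d n x\<bar> \<partial>M) + B * \<bar>Y n\<bar> * (2 * \<epsilon> n + 2 * (\<integral>x. (v x)\<^sup>2 \<partial>M))"
        using wd[of n] d2[of n] v2 by (simp add: \<epsilon>_def)
      also have "(\<integral>x. \<bar>w x\<bar> * \<bar>d n x\<bar> \<partial>M) \<le> sqrt (\<integral>x. (w x)\<^sup>2 \<partial>M) * sqrt (\<epsilon> n)"
        using Cauchy_Schwarz_integral[of "\<lambda>x. \<bar>w x\<bar>" M "\<lambda>x. \<bar>d n x\<bar>"] w2 d2[of n] by (simp add: \<epsilon>_def)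
      finally show ?thesis using B0 by (simp add: mult_left_mono)
    qed
    moreover have "(\<lambda>n. B * (sqrt (\<integral>x. (w x)\<^sup>2 \<partial>M) * sqrt (\<epsilon> n)) + B * \<bar>Y n\<bar> * (2 * \<epsilon> n + 2 * (\<integral>x. (v x)\<^sup>2 \<partial>M)))
        \<longlonglongrightarrow> B * (sqrt (\<integral>x. (w x)\<^sup>2 \<partial>M) * sqrt 0) + B * \<bar>0\<bar> * (2 * 0 + 2 * (\<integral>x. (v x)\<^sup>2 \<partial>M))"
      by (intro tendsto_intros \<epsilon> Y)
    ultimately have E: "E \<longlonglongrightarrow> 0"
      by (intro Lim_null_comparison[of E, OF always_eventually]) simp_all

    have G: "(\<lambda>n. \<integral>x. g n (w x) * v x \<partial>M) \<longlonglongrightarrow> (\<integral>x. q t * tpow (exp (\<kappa> t)) (q t) (w x) * v x \<partial>M)"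
    proof (rule integral_dominated_convergence[where w = "\<lambda>x. B * (\<bar>w x\<bar> * \<bar>v x\<bar>)"])
      show "AE x in M. (\<lambda>n. g n (w x) * v x) \<longlonglongrightarrow> q t * tpow (exp (\<kappa> t)) (q t) (w x) * v x"
        unfolding g_def using q2 Y(3) t by (intro AE_I2 tendsto_intros tendsto_tpow_param kY qY) auto
      show "AE x in M. norm (g n (w x) * v x) \<le> B * (\<bar>w x\<bar> * \<bar>v x\<bar>)" for n
        using gb B0 by (intro AE_I2) (simp add: abs_mult mult_right_mono flip: mult.assoc)
    qed (use wv in auto)

    \<comment> \<open>Here only the parameters move. The pointwise limit is the derivative at fixed
      argument, and the mean value inequality over the ball supplies the majorant C w^2.\<close>
    define h where "h n x = (\<psi> n (w x) - lin_powr (exp (\<kappa> t)) (q t) (w x)) / Y n" for n x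
    have T: "(\<lambda>n. \<integral>x. h n x \<partial>M) \<longlonglongrightarrow> (\<integral>x. lin_powr_dt (\<kappa> t) (\<kappa>' t) (q t) (q' t) (w x) \<partial>M)"
    proof (rule integral_dominated_convergence[where w = "\<lambda>x. C * (w x)\<^sup>2"])
      have der: "((\<lambda>\<tau>. lin_powr (exp (\<kappa> \<tau>)) (q \<tau>) s) has_real_derivative
           lin_powr_dt (\<kappa> \<tau>) (\<kappa>' \<tau>) (q \<tau>) (q' \<tau>) s) (at \<tau>)" if "\<tau> \<in> ball t \<delta>" for \<tau> s
        using q2[OF that] by (intro has_real_derivative_lin_powr \<kappa> q that) auto
      show "AE x in M. (\<lambda>n. h n x) \<longlonglongrightarrow> lin_powr_dt (\<kappa> t) (\<kappa>' t) (q t) (q' t) (w x)"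
      proof (rule AE_I2)
        fix x
        show "(\<lambda>n. h n x) \<longlonglongrightarrow> lin_powr_dt (\<kappa> t) (\<kappa>' t) (q t) (q' t) (w x)"
          using der[OF t, of "w x"] Y(1,2)
          unfolding DERIV_def tendsto_at_iff_sequentially h_def \<psi>_def comp_def by auto
      qed
      show "AE x in M. norm (h n x) \<le> C * (w x)\<^sup>2" for n
      proof (rule AE_I2)
        fix x
        have "norm (lin_powr (exp (\<kappa> (t + Y n))) (q (t + Y n)) (w x) - lin_powr (exp (\<kappa> t)) (q t) (w x))
          \<le> (C * (w x)\<^sup>2) * norm (t + Y n - t)"
        proof (rule field_differentiable_bound[OF convex_ball _ _ Y(3) t])
          fix z assume z: "z \<in> ball t \<delta>"
          show "((\<lambda>\<tau>. lin_powr (exp (\<kappa> \<tau>)) (q \<tau>) (w x)) has_real_derivative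
             lin_powr_dt (\<kappa> z) (\<kappa>' z) (q z) (q' z) (w x)) (at z within ball t \<delta>)"
            using der[OF z] by (rule has_field_derivative_at_within)
          show "norm (lin_powr_dt (\<kappa> z) (\<kappa>' z) (q z) (q' z) (w x)) \<le> C * (w x)\<^sup>2"
            unfolding C_def real_norm_def using z by (intro lin_powr_dt_bound r0 bnd)
        qed
        then show "norm (h n x) \<le> C * (w x)\<^sup>2"
          using Y(2)[of n] by (simp add: h_def \<psi>_def field_simps)
      qed
      show "(\<lambda>x. lin_powr_dt (\<kappa> t) (\<kappa>' t) (q t) (q' t) (w x)) \<in> borel_measurable M"
        unfolding lin_powr_dt_def Phi_def by measurable
      show "h n \<in> borel_measurable M" for n
        unfolding h_def by measurable
    qed (use w2 in auto)

    have "(F (t + Y n) - F t) / Y n = (\<integral>x. h n x \<partial>M) + (\<integral>x. g n (w x) * v x \<partial>M) + E n" for n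
    proof -
      have "(\<integral>x. h n x \<partial>M) = ((\<integral>x. \<psi> n (w x) \<partial>M) - F t) / Y n"
        unfolding h_def F_def using i\<psi>[of n] i0 by (simp add: w_def)
      moreover have "E n = (F (t + Y n) - (\<integral>x. \<psi> n (w x) \<partial>M)) / Y n - (\<integral>x. g n (w x) * v x \<partial>M)"
        unfolding E_def F_def using i\<psi>[of n] gv[of n] by (simp add: \<psi>_def U_def)
      ultimately show ?thesis
        by (simp add: diff_divide_distrib)
    qed
    moreover have "(\<lambda>n. (\<integral>x. h n x \<partial>M) + (\<integral>x. g n (w x) * v x \<partial>M) + E n) \<longlonglongrightarrow> D + 0"
      unfolding D_def by (intro tendsto_add T G E)
    ultimately show ?thesis by simp
  qed
  have "((\<lambda>h. (F (t + h) - F t) / h) \<longlongrightarrow> D) (at 0)"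
    unfolding tendsto_at_iff_sequentially comp_def
  proof (intro allI impI)
    fix X :: "nat \<Rightarrow> real" assume X: "\<forall>i. X i \<in> UNIV - {0}" "X \<longlonglongrightarrow> 0"
    have "\<forall>\<^sub>F n in sequentially. \<bar>X n\<bar> < \<delta>"
      using X(2) \<delta> by (metis order_tendstoD(2) tendsto_rabs_zero)
    then obtain N where N: "\<And>n. N \<le> n \<Longrightarrow> \<bar>X n\<bar> < \<delta>"
      by (auto simp: eventually_sequentially)
    have "(\<lambda>n. (F (t + X (n + N)) - F t) / X (n + N)) \<longlonglongrightarrow> D"
    proof (rule key)
      show "(\<lambda>n. X (n + N)) \<longlonglongrightarrow> 0" using X(2) by (rule LIMSEQ_ignore_initial_segment)
      show "X (n + N) \<noteq> 0" for n using X(1) by auto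
      show "t + X (n + N) \<in> ball t \<delta>" for n using N[of "n + N"] by (simp add: dist_real_def)
    qed
    then show "(\<lambda>n. (F (t + X n) - F t) / X n) \<longlonglongrightarrow> D"
      by (rule LIMSEQ_offset)
  qed
  then show ?thesis
    unfolding DERIV_def F_def D_def w_def .
qed

section \<open>The differential inequality and its integration\<close>

text \<open>
  The rate \<open>g\<close> is merely integrable. For the Henstock--Kurzweil integral the fundamental theorem
  of calculus needs no regularity of the derivative, so a pointwise bound on the derivative above
  the barrier suffices.
\<close>

lemma exp_integral_barrier:
  fixes N q g :: "real \<Rightarrow> real"
  assumes T: "0 < T" and cN: "continuous_on {0..T} N" and cq: "continuous_on {0..T} q"
    and qpos: "\<And>t. t \<in> {0..T} \<Longrightarrow> 0 < q t" and g: "g integrable_on {0..T}"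
    and N0: "N 0 \<le> exp (q 0 * a)"
    and step: "\<And>t. 0 < t \<Longrightarrow> t < T \<Longrightarrow> exp (q t * (a + integral {0..t} g)) < N t \<Longrightarrow>
       \<exists>d\<le>g t. ((\<lambda>t. ln (N t) / q t) has_real_derivative d) (at t)"
  shows "N T \<le> exp (q T * (a + integral {0..T} g))"
proof (rule ccontr)
  assume contra: "\<not> ?thesis"
  define Z where "Z t = exp (q t * (a + integral {0..t} g))" for t
  have cZ: "continuous_on {0..T} Z"
    unfolding Z_def by (intro continuous_intros cq indefinite_integral_continuous_1 g)
  define S where "S = {t \<in> {0..T}. N t \<le> Z t}"
  have "compact S"
    unfolding S_def compact_eq_bounded_closed
    by (intro conjI continuous_on_closed_Collect_le cN cZ bounded_subset[OF bounded_closed_interval[of 0 T]]) auto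
  moreover have "0 \<in> S" using N0 T by (simp add: S_def Z_def)
  \<comment> \<open>The last time at which N is not above the barrier. From there to T the bound on
    the derivative is available throughout, and continuity forces equality at
    \<open>t0\<close>.\<close>
  ultimately obtain t0 where t0: "t0 \<in> S" "\<And>t. t \<in> S \<Longrightarrow> t \<le> t0"
    using compact_attains_sup[of S] by auto
  have "T \<notin> S" using contra by (simp add: S_def Z_def)
  with t0 have t0T: "0 \<le> t0" "t0 < T" by (auto simp: S_def order_less_le)
  have above: "Z t < N t" if "t0 < t" "t \<le> T" for t
    using t0(2)[of t] that t0T by (fastforce simp: S_def not_le[symmetric])
  have "continuous_on {t0..T} (\<lambda>t. N t - Z t)"
    using t0T by (intro continuous_intros continuous_on_subset[OF cN] continuous_on_subset[OF cZ]) auto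
  then obtain x where "t0 \<le> x" "x \<le> T" "N x - Z x = 0"
    using IVT'[of "\<lambda>t. N t - Z t" t0 0 T] t0 t0T above[of T] by (auto simp: S_def)
  then have "x = t0" using t0(2)[of x] t0T by (auto simp: S_def)
  with \<open>N x - Z x = 0\<close> have Nt0: "N t0 = Z t0" by simp
  have Npos: "0 < N t" if "t \<in> {t0..T}" for t
  proof -
    have "0 < Z t" by (simp add: Z_def)
    then show ?thesis
      using above[of t] Nt0 that by (cases "t = t0") auto
  qed
  have cy: "continuous_on {t0..T} (\<lambda>t. ln (N t) / q t)"
  proof (intro continuous_on_divide continuous_on_ln ballI)
    show "continuous_on {t0..T} N" "continuous_on {t0..T} q"
      using t0T by (auto intro: continuous_on_subset[OF cN] continuous_on_subset[OF cq])
    fix t assume t: "t \<in> {t0..T}"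
    show "N t \<noteq> 0" using Npos[OF t] by simp
    show "q t \<noteq> 0" using qpos[of t] t t0T by simp
  qed
  obtain d where d: "\<And>t. t \<in> {t0<..<T} \<Longrightarrow> d t \<le> g t \<and> ((\<lambda>t. ln (N t) / q t) has_real_derivative d t) (at t)"
  proof -
    have "\<exists>d\<le>g t. ((\<lambda>t. ln (N t) / q t) has_real_derivative d) (at t)" if "t \<in> {t0<..<T}" for t
      using that t0T above[of t] by (intro step) (auto simp: Z_def)
    then have "\<forall>t\<in>{t0<..<T}. \<exists>d. d \<le> g t \<and> ((\<lambda>t. ln (N t) / q t) has_real_derivative d) (at t)"
      by blast
    from bchoice[OF this] show ?thesis using that by blast
  qed
  \<comment> \<open>At the end points, where no derivative is given, the integrand is set to
    \<open>g\<close>, so that it stays below \<open>g\<close> on the closed interval.\<close>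
  have "((\<lambda>t. if t \<in> {t0<..<T} then d t else g t) has_integral (ln (N T) / q T - ln (N t0) / q t0)) {t0..T}"
  proof (rule fundamental_theorem_of_calculus_interior)
    fix t assume t: "t \<in> {t0<..<T}"
    with d[OF t] show "((\<lambda>t. ln (N t) / q t) has_vector_derivative (if t \<in> {t0<..<T} then d t else g t)) (at t)"
      by (simp add: has_real_derivative_iff_has_vector_derivative)
  qed (use t0T cy in auto)
  moreover have gi: "g integrable_on {t0..T}"
    using g t0T by (auto intro: integrable_on_subinterval)
  ultimately have "ln (N T) / q T - ln (N t0) / q t0 \<le> integral {t0..T} g"
    using d by (intro has_integral_le[OF _ integrable_integral]) auto
  also have "\<dots> = integral {0..T} g - integral {0..t0} g"
    using Henstock_Kurzweil_Integration.integral_combine[of 0 t0 T g] g t0T by simp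
  also have "ln (N t0) / q t0 = a + integral {0..t0} g"
    using qpos[of t0] t0T unfolding Nt0 Z_def by simp
  finally have "ln (N T) \<le> q T * (a + integral {0..T} g)"
    using qpos[of T] T by (simp add: field_simps)
  then have "N T \<le> Z T"
    unfolding Z_def using Npos[of T] t0T by (metis atLeastAtMost_iff exp_le_cancel_iff exp_ln less_imp_le order_refl)
  with contra show False by (simp add: Z_def)
qed

text \<open>
  \<open>M\<close> and \<open>X\<close> stand for the integrals of the truncated power and of the excess. The terms with \<open>X\<close> are absorbed by the negative \<open>\<kappa>'\<close>, except for those values of
  \<open>c / d\<close> that exceed \<open>B\<close>.
\<close>

lemma entropy_differential_inequality:
  fixes r R d c I M X N e \<kappa> \<kappa>' Q B \<Lambda> :: real
  assumes d: "0 < d" and r: "2 \<le> r" "r \<le> R" and M: "0 \<le> M" and X: "0 \<le> X" and N: "N = M + X" "0 < N"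
    and LS: "I - Phi M \<le> c * M + d * e"
    and \<kappa>': "\<kappa>' = - (Q * \<kappa> + (Q * (1 + \<Lambda>) + B * R))" and \<kappa>: "0 \<le> \<kappa>"
    and Q: "r\<^sup>2 / d \<le> Q" and \<Lambda>: "0 \<le> \<Lambda>" and B: "0 \<le> B" and lnN: "- (r * \<Lambda>) \<le> ln N"
  shows "(r / d * (I + (1 + r * \<kappa>) * X) + (r - 1) * \<kappa>' * X - r * e) / (N * r) - ln N / d
           \<le> c / d + max 0 (\<bar>c / d\<bar> - B)"
proof -
  have r0: "0 < r" using r by simp
  \<comment> \<open>Q bounds q' = r^2 / d; the X-terms will appear divided by r, hence this
    form.\<close>
  have Qr: "r / d \<le> Q / r" using Q r0 by (simp add: field_simps power2_eq_square)
  have "1 * (1 / d) \<le> r * (1 / d)" using r d by (intro mult_right_mono) auto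
  then have Q1: "1 / d \<le> Q / r" using Qr by simp
  have Q0: "0 \<le> Q" using Q d by (meson divide_nonneg_nonneg less_imp_le order_trans zero_le_power2)
  \<comment> \<open>The entropy inequality involves ln M, the derivative of ln N / q involves ln N;
    M \<le> N permits the exchange.\<close>
  have MlnM: "Phi M \<le> M * ln N"
  proof (cases "M = 0")
    case False
    then show ?thesis using M N X by (auto simp: Phi_def intro!: mult_left_mono)
  qed (simp add: Phi_def)
  have "I - d * e \<le> c * M + M * ln N" using LS MlnM by simp
  then have "(r / d) * (I - d * e) \<le> (r / d) * (c * M + M * ln N)"
    using r0 d by (intro mult_left_mono) auto
  then have "r / d * (I + (1 + r * \<kappa>) * X) + (r - 1) * \<kappa>' * X - r * e
      \<le> (r / d) * (c * M + M * ln N + (1 + r * \<kappa>) * X) + (r - 1) * \<kappa>' * X"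
    using d by (simp add: algebra_simps)
  \<comment> \<open>Substitute M = N - X: the coefficient of N becomes the desired (c + ln N) / d,
    and the surplus is charged to X.\<close>
  also have "\<dots> = r * (N * ((c + ln N) / d) + X * ((- c - ln N + 1 + r * \<kappa>) / d + (r - 1) * \<kappa>' / r))"
    using r0 d unfolding N(1) by (simp add: field_simps)
  finally have "(r / d * (I + (1 + r * \<kappa>) * X) + (r - 1) * \<kappa>' * X - r * e) / (N * r)
     \<le> r * (N * ((c + ln N) / d) + X * ((- c - ln N + 1 + r * \<kappa>) / d + (r - 1) * \<kappa>' / r)) / (N * r)"
    using N(2) r0 by (intro divide_right_mono) auto
  also have "\<dots> = (c + ln N) / d + (X / N) * ((- c - ln N + 1 + r * \<kappa>) / d + (r - 1) * \<kappa>' / r)"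
    using N(2) r0 by (simp add: field_simps)
  also have "(X / N) * ((- c - ln N + 1 + r * \<kappa>) / d + (r - 1) * \<kappa>' / r) \<le> (X / N) * (\<bar>c / d\<bar> - B)"
  proof (rule mult_left_mono)
    have "- ln N / d \<le> (r * \<Lambda>) / d" using lnN d by (intro divide_right_mono) auto
    also have "\<dots> \<le> (Q / r) * \<Lambda>" using mult_right_mono[OF Qr \<Lambda>] by simp
    finally have 1: "- ln N / d \<le> (Q / r) * \<Lambda>" .
    have 2: "r * \<kappa> / d \<le> (Q / r) * \<kappa>" using mult_right_mono[OF Qr \<kappa>] by simp
    have "0 \<le> Q * \<kappa> + (Q * (1 + \<Lambda>) + B * R)" using Q0 \<kappa> \<Lambda> B r by auto
    then have "1 * (Q * \<kappa> + (Q * (1 + \<Lambda>) + B * R)) \<le> (r - 1) * (Q * \<kappa> + (Q * (1 + \<Lambda>) + B * R))"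
      using r by (intro mult_right_mono) auto
    then have "(r - 1) * \<kappa>' \<le> - (Q * \<kappa> + (Q * (1 + \<Lambda>) + B * R))"
      unfolding \<kappa>' mult_minus_right neg_le_iff_le by (simp only: mult_1_left)
    then have "(r - 1) * \<kappa>' / r \<le> - (Q * \<kappa> + (Q * (1 + \<Lambda>) + B * R)) / r"
      using r0 by (intro divide_right_mono) auto
    also have "\<dots> = - (Q / r) * \<kappa> - (Q / r) * (1 + \<Lambda>) - B * R / r"
      using r0 by (simp add: field_simps)
    \<comment> \<open>The factor R in \<kappa>' makes up for the division by r \<le> R, so that a
      full B is left over.\<close>
    also have "B * 1 \<le> B * (R / r)" using B r r0 by (intro mult_left_mono) auto
    then have "- (Q / r) * \<kappa> - (Q / r) * (1 + \<Lambda>) - B * R / r \<le> - (Q / r) * \<kappa> - (Q / r) * (1 + \<Lambda>) - B"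
      by simp
    finally have 3: "(r - 1) * \<kappa>' / r \<le> - (Q / r) * \<kappa> - (Q / r) * (1 + \<Lambda>) - B" .
    have "(- c - ln N + 1 + r * \<kappa>) / d = - (c / d) + - ln N / d + 1 / d + r * \<kappa> / d"
      by (simp add: add_divide_distrib diff_divide_distrib)
    moreover have "- (c / d) \<le> \<bar>c / d\<bar>" by (rule abs_ge_minus_self)
    ultimately show "(- c - ln N + 1 + r * \<kappa>) / d + (r - 1) * \<kappa>' / r \<le> \<bar>c / d\<bar> - B"
      using 1 2 3 Q1 unfolding distrib_left by linarith
    show "0 \<le> X / N" using X N by simp
  qed
  \<comment> \<open>Since 0 \<le> X / N \<le> 1, the product is nonpositive below the threshold and
    at most the tail above it.\<close>
  also have "(X / N) * (\<bar>c / d\<bar> - B) \<le> max 0 (\<bar>c / d\<bar> - B)"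
  proof (cases "\<bar>c / d\<bar> \<le> B")
    case True
    then have "(X / N) * (\<bar>c / d\<bar> - B) \<le> 0"
      using X N by (intro mult_nonneg_nonpos) auto
    then show ?thesis by simp
  next
    case False
    then have "(X / N) * (\<bar>c / d\<bar> - B) \<le> 1 * (\<bar>c / d\<bar> - B)"
      using X N M by (intro mult_right_mono) auto
    then show ?thesis by simp
  qed
  finally show ?thesis by (simp add: add_divide_distrib)
qed

section \<open>Hypercontractive bounds for solutions with square-integrable data\<close>

lemma integrable_min_powr:
  fixes w :: "'b \<Rightarrow> real"
  assumes [measurable]: "w \<in> borel_measurable M" and w2: "integrable M (\<lambda>x. (w x)\<^sup>2)"
    and k: "0 < k" and r: "2 \<le> r"
  shows "integrable M (\<lambda>x. min \<bar>w x\<bar> k powr r)"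
proof (rule Bochner_Integration.integrable_bound)
  show "integrable M (\<lambda>x. lin_powr k r (w x))" by (rule integrable_lin_powr[OF assms])
  show "AE x in M. norm (min \<bar>w x\<bar> k powr r) \<le> norm (lin_powr k r (w x))"
    using excess_nonneg[OF k, of r] r by (simp add: lin_powr_def)
qed measurable

lemma integrable_excess:
  assumes "w \<in> borel_measurable M" "integrable M (\<lambda>x. (w x)\<^sup>2)" "0 < k" "2 \<le> r"
  shows "integrable M (\<lambda>x. excess k r (w x))"
  using Bochner_Integration.integrable_diff[OF integrable_lin_powr[OF assms] integrable_min_powr[OF assms]]
  by (simp add: lin_powr_def)

lemma tendsto_lpnorm_2_iff:
  "((\<lambda>n. lpnorm 2 (f n)) \<longlongrightarrow> 0) F \<longleftrightarrow> ((\<lambda>n. \<integral>x. (f n x)\<^sup>2 \<partial>lborel) \<longlongrightarrow> 0) F"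
proof
  assume "((\<lambda>n. lpnorm 2 (f n)) \<longlongrightarrow> 0) F"
  then have "((\<lambda>n. (lpnorm 2 (f n))\<^sup>2) \<longlongrightarrow> 0\<^sup>2) F" by (rule tendsto_power)
  then show "((\<lambda>n. \<integral>x. (f n x)\<^sup>2 \<partial>lborel) \<longlongrightarrow> 0) F" by (simp add: lpnorm_2)
next
  assume "((\<lambda>n. \<integral>x. (f n x)\<^sup>2 \<partial>lborel) \<longlongrightarrow> 0) F"
  from tendsto_real_sqrt[OF this] show "((\<lambda>n. lpnorm 2 (f n)) \<longlongrightarrow> 0) F" by (simp add: lpnorm_2)
qed

lemma continuous_on_integral_lin_powr:
  fixes u :: "real \<Rightarrow> 'a::euclidean_space \<Rightarrow> real"
  assumes sol: "l2_solution J f u" and \<kappa>: "continuous_on {0..T} \<kappa>" and q: "continuous_on {0..T} q"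
    and bnd: "\<And>t. t \<in> {0..T} \<Longrightarrow> 0 \<le> \<kappa> t" "\<And>t. t \<in> {0..T} \<Longrightarrow> \<kappa> t \<le> K"
      "\<And>t. t \<in> {0..T} \<Longrightarrow> 2 \<le> q t" "\<And>t. t \<in> {0..T} \<Longrightarrow> q t \<le> R"
  shows "continuous_on {0..T} (\<lambda>t. \<integral>x. lin_powr (exp (\<kappa> t)) (q t) (u t x) \<partial>lborel)"
  unfolding continuous_on_sequentially comp_def
proof (intro allI ballI impI, elim conjE)
  fix X :: "nat \<Rightarrow> real" and a
  assume a: "a \<in> {0..T}" and X: "\<forall>n. X n \<in> {0..T}" "X \<longlonglongrightarrow> a"
  have mem: "memLp 2 (u t)" if "0 \<le> t" for t
    using sol that by (simp add: l2_solution_def)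
  have um: "u t \<in> borel_measurable lborel" "integrable lborel (\<lambda>x. (u t x)\<^sup>2)" if "0 \<le> t" for t
    using mem[OF that] unfolding memLp_2_iff by blast+
  have "((\<lambda>s. lpnorm 2 (\<lambda>x. u s x - u a x)) \<longlongrightarrow> 0) (at a within {0..})"
    using sol a by (simp add: l2_solution_def)
  \<comment> \<open>The limit within [0,\<infinity>) ignores the point a itself, while the sequence
    may take the value a; continuity, with value 0 at a, covers both.\<close>
  then have "continuous (at a within {0..}) (\<lambda>s. lpnorm 2 (\<lambda>x. u s x - u a x))"
    by (simp add: continuous_within lpnorm_2)
  then have "(\<lambda>n. lpnorm 2 (\<lambda>x. u (X n) x - u a x)) \<longlonglongrightarrow> lpnorm 2 (\<lambda>x. u a x - u a x)"
    by (rule continuous_within_tendsto_compose[OF _ _ X(2)]) (use X(1) in auto)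
  then have "(\<lambda>n. lpnorm 2 (\<lambda>x. u (X n) x - u a x)) \<longlonglongrightarrow> 0"
    by (simp add: lpnorm_2)
  then have lim: "(\<lambda>n. \<integral>x. (u (X n) x - u a x)\<^sup>2 \<partial>lborel) \<longlonglongrightarrow> 0"
    by (simp add: tendsto_lpnorm_2_iff)
  show "(\<lambda>n. \<integral>x. lin_powr (exp (\<kappa> (X n))) (q (X n)) (u (X n) x) \<partial>lborel)
     \<longlonglongrightarrow> (\<integral>x. lin_powr (exp (\<kappa> a)) (q a) (u a x) \<partial>lborel)"
    using X a bnd um
    by (intro tendsto_integral_lin_powr[where K = K and R = R] lim
        continuous_on_tendsto_compose[OF \<kappa>] continuous_on_tendsto_compose[OF q]) auto
qed

lemma integrable_add_tail:
  fixes c :: "real \<Rightarrow> real"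
  assumes c: "c absolutely_integrable_on {0..T}"
  shows "(\<lambda>s. c s + max 0 (\<bar>c s\<bar> - B)) integrable_on {0..T}"
proof -
  have "(\<lambda>s. max 0 (\<bar>c s\<bar> - B)) absolutely_integrable_on {0..T}"
    using absolutely_integrable_norm[OF c]
    by (intro absolutely_integrable_max_1 set_integral_diff) (auto simp: comp_def)
  then show ?thesis
    using c by (intro integrable_add) (auto simp: absolutely_integrable_on_def)
qed

text \<open>The right-hand side does not contain k. The initial level grows with k, yet at time 0
  the modified power never exceeds the full one, and the bound on the logarithmic derivative of the
  functional is the same for all levels. The threshold B enters only through the tail of C / D. Both
  can thus be sent to infinity afterwards.\<close>

lemma l2_solution_integral_bound:
  fixes J :: "'a::euclidean_space \<Rightarrow> 'a \<Rightarrow> real" and u :: "real \<Rightarrow> 'a \<Rightarrow> real"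
  assumes J: "levy_kernel J" and p: "2 \<le> p"
    and D: "\<And>r. p \<le> r \<Longrightarrow> 0 < D r" and LS: "\<And>r. p \<le> r \<Longrightarrow> log_sobolev J r (C r) (D r)"
    and T: "0 < T" and q0: "q 0 = p" and contq: "continuous_on {0..T} q"
    and qge: "\<And>t. t \<in> {0..T} \<Longrightarrow> p \<le> q t"
    and dq: "\<And>t. 0 < t \<Longrightarrow> t < T \<Longrightarrow> (q has_real_derivative (q t)\<^sup>2 / D (q t)) (at t)"
    and Q: "\<And>t. t \<in> {0..T} \<Longrightarrow> (q t)\<^sup>2 / D (q t) \<le> Q"
    and CD: "(\<lambda>t. C (q t) / D (q t)) absolutely_integrable_on {0..T}"
    and sol: "l2_solution J f u" and f: "memLp p f" and a: "(\<integral>x. \<bar>f x\<bar> powr p \<partial>lborel) \<le> exp (p * a)"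
    and B: "0 \<le> B" and k: "0 \<le> k"
  shows "(\<integral>x. min \<bar>u T x\<bar> (exp k) powr (q T) \<partial>lborel)
    \<le> exp (q T * (a + integral {0..T} (\<lambda>s. C (q s) / D (q s) + max 0 (\<bar>C (q s) / D (q s)\<bar> - B))))"
proof -
  define c where "c = (\<lambda>t. C (q t) / D (q t))"
  define g where "g = (\<lambda>s. c s + max 0 (\<bar>c s\<bar> - B))"
  have c_abs: "c absolutely_integrable_on {0..T}"
    using CD by (simp add: c_def)
  then have absc: "(\<lambda>t. \<bar>c t\<bar>) integrable_on {0..T}"
    by (auto simp: absolutely_integrable_on_def)
  have gi: "g integrable_on {0..T}"
    unfolding g_def by (rule integrable_add_tail[OF c_abs])
  \<comment> \<open>A lower bound for the exponent of the barrier: since g \<ge> - |c|, any value of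
    N above the barrier satisfies ln N \<ge> - q \<Lambda>.\<close>
  define \<Lambda> where "\<Lambda> = \<bar>a\<bar> + integral {0..T} (\<lambda>t. \<bar>c t\<bar>)"
  have \<Lambda>0: "0 \<le> \<Lambda>"
    unfolding \<Lambda>_def by (intro add_nonneg_nonneg Henstock_Kurzweil_Integration.integral_nonneg absc) auto
  have \<Lambda>: "- \<Lambda> \<le> a + integral {0..t} g" if "t \<in> {0..T}" for t
  proof -
    have "- integral {0..T} (\<lambda>t. \<bar>c t\<bar>) \<le> - integral {0..t} (\<lambda>t. \<bar>c t\<bar>)"
      using that absc by (intro le_imp_neg_le integral_subset_le integrable_on_subinterval[OF absc]) auto
    also have "\<dots> = integral {0..t} (\<lambda>t. - \<bar>c t\<bar>)" by simp
    also have "\<dots> \<le> integral {0..t} g"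
      using that integrable_on_subinterval[OF absc, of 0 t] integrable_on_subinterval[OF gi, of 0 t]
      by (intro integral_le integrable_neg) (auto simp: g_def)
    finally show ?thesis unfolding \<Lambda>_def by linarith
  qed
  have qpos: "0 < q t" if "t \<in> {0..T}" for t using qge[OF that] p by simp
  have dqpos: "0 < (q t)\<^sup>2 / D (q t)" if "t \<in> {0..T}" for t
    using qpos[OF that] D[OF qge[OF that]] by simp
  have Qpos: "0 < Q"
    using dqpos[of 0] Q[of 0] T by simp
  \<comment> \<open>Strictness matters: it gives q t > 2 for every t > 0 even when p = 2.\<close>
  have qmono: "q s < q t" if "0 \<le> s" "s < t" "t \<le> T" for s t
  proof (rule DERIV_pos_imp_increasing_open[OF that(2)])
    show "\<exists>y. (q has_real_derivative y) (at x) \<and> 0 < y" if "s < x" "x < t" for x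
      using dq[of x] dqpos[of x] that \<open>0 \<le> s\<close> \<open>t \<le> T\<close> by auto
    show "continuous_on {s..t} q" using that by (intro continuous_on_subset[OF contq]) auto
  qed
  define R where "R = q T"
  have qR: "q t \<le> R" if "t \<in> {0..T}" for t
    using qmono[of t T] that by (cases "t = T") (auto simp: R_def)
  \<comment> \<open>The part of the X-terms that is free of \<kappa>: Q for 1 / d, Q \<Lambda> for -
    ln N / d, and B R for |c| up to the threshold.\<close>
  define \<beta> where "\<beta> = Q * (1 + \<Lambda>) + B * R"
  have \<beta>0: "0 \<le> \<beta>"
    using Qpos \<Lambda>0 B qpos[of T] T by (simp add: \<beta>_def R_def)
  \<comment> \<open>the solution of \<open>\<kappa>' = - (Q * \<kappa> + \<beta>)\<close> with the level at the final time \<open>T\<close> prescribed\<close>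
  define \<kappa> where "\<kappa> = (\<lambda>t. (k + \<beta> / Q) * exp (Q * (T - t)) - \<beta> / Q)"
  define \<kappa>' where "\<kappa>' = (\<lambda>t. - (Q * \<kappa> t + \<beta>))"
  have \<kappa>_T: "\<kappa> T = k" by (simp add: \<kappa>_def)
  have d\<kappa>: "(\<kappa> has_real_derivative \<kappa>' t) (at t)" for t
    unfolding \<kappa>_def \<kappa>'_def using Qpos by (auto intro!: derivative_eq_intros simp: field_simps)
  have kb: "0 \<le> k + \<beta> / Q" using k \<beta>0 Qpos by simp
  have \<kappa>0: "0 \<le> \<kappa> t" if "t \<le> T" for t
  proof -
    have "(k + \<beta> / Q) * 1 \<le> (k + \<beta> / Q) * exp (Q * (T - t))"
      using kb Qpos that by (intro mult_left_mono) auto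
    then show ?thesis using k by (simp add: \<kappa>_def)
  qed
  define K where "K = \<kappa> 0"
  have \<kappa>K: "\<kappa> t \<le> K" if "0 \<le> t" for t
    unfolding K_def \<kappa>_def using kb Qpos that by (intro diff_right_mono mult_left_mono) auto
  have cont\<kappa>: "continuous_on {0..T} \<kappa>"
    unfolding \<kappa>_def by (intro continuous_intros)
  obtain v where v: "\<And>t. 0 < t \<Longrightarrow> memLp 2 (v t)"
     "\<And>t. 0 < t \<Longrightarrow> ((\<lambda>h. lpnorm 2 (\<lambda>x. (u (t + h) x - u t x) / h - v t x)) \<longlongrightarrow> 0) (at 0)"
     "\<And>t. 0 < t \<Longrightarrow> levy_operator J (u t) (\<lambda>x. - v t x)"
    using sol unfolding l2_solution_def by blast
  have mem: "memLp 2 (u t)" if "0 \<le> t" for t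
    using sol that by (simp add: l2_solution_def)
  have um: "u t \<in> borel_measurable lborel" and u2: "integrable lborel (\<lambda>x. (u t x)\<^sup>2)" if "0 \<le> t" for t
    using mem[OF that] unfolding memLp_2_iff by blast+
  define N where "N = (\<lambda>t. \<integral>x. lin_powr (exp (\<kappa> t)) (q t) (u t x) \<partial>lborel)"

  have "N T \<le> exp (q T * (a + integral {0..T} g))"
  proof (rule exp_integral_barrier[OF T _ contq qpos gi])
    show "continuous_on {0..T} N"
      unfolding N_def
    proof (rule continuous_on_integral_lin_powr[OF sol cont\<kappa> contq])
      fix t assume "t \<in> {0..T}"
      then show "0 \<le> \<kappa> t" "\<kappa> t \<le> K" "2 \<le> q t" "q t \<le> R"
        using \<kappa>0[of t] \<kappa>K[of t] qge[of t] qR[of t] p by auto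
    qed
    have "N 0 \<le> (\<integral>x. \<bar>f x\<bar> powr p \<partial>lborel)"
      unfolding N_def q0
    proof (rule integral_mono_AE)
      show "integrable lborel (\<lambda>x. lin_powr (exp (\<kappa> 0)) p (u 0 x))"
        using um[of 0] u2[of 0] p by (intro integrable_lin_powr) auto
      show "integrable lborel (\<lambda>x. \<bar>f x\<bar> powr p)" using f by (simp add: memLp_def)
      have "AE x in lborel. u 0 x = f x" using sol by (simp add: l2_solution_def)
      then show "AE x in lborel. lin_powr (exp (\<kappa> 0)) p (u 0 x) \<le> \<bar>f x\<bar> powr p"
      proof eventually_elim
        case (elim x)
        then show ?case using lin_powr_le_powr[of "exp (\<kappa> 0)" p "f x"] p by simp
      qed
    qed
    then show "N 0 \<le> exp (q 0 * a)" using a q0 by simp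
  next
    fix t assume t: "0 < t" "t < T" and above: "exp (q t * (a + integral {0..t} g)) < N t"
    define r where "r = q t"
    define r' where "r' = (q t)\<^sup>2 / D (q t)"
    have tT: "t \<in> {0..T}" using t by simp
    have r: "2 < r" "r \<le> R" "p \<le> r"
      using qmono[of 0 t] q0 p t qR[OF tT] by (auto simp: r_def)
    have Dr: "0 < D r" using D r by simp
    define w where "w = u t"
    have wm [measurable]: "w \<in> borel_measurable lborel" and w2: "integrable lborel (\<lambda>x. (w x)\<^sup>2)"
      using um[of t] u2[of t] t by (auto simp: w_def)
    have wH: "w \<in> HL J" using v(3)[OF t(1)] by (simp add: levy_operator_def w_def)
    \<comment> \<open>The energy produced by the equation, finite because the test function lies in
      the form domain. The motion of u contributes - (r e) to the derivative of the
      functional.\<close>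
    define e where "e = (\<integral>x. - v t x * tpow (exp (\<kappa> t)) r (w x) \<partial>lborel)"
    have "(\<lambda>x. tpow (exp (\<kappa> t)) r (w x)) \<in> HL J"
      using r by (intro tpow_comp_HL J wH) auto
    then have E: "energy J w (\<lambda>x. tpow (exp (\<kappa> t)) r (w x)) = ereal e"
      using v(3)[OF t(1)] by (simp add: levy_operator_def w_def e_def)
    define M where "M = (\<integral>x. min \<bar>w x\<bar> (exp (\<kappa> t)) powr r \<partial>lborel)"
    define I where "I = (\<integral>x. Phi (min \<bar>w x\<bar> (exp (\<kappa> t)) powr r) \<partial>lborel)"
    define X where "X = (\<integral>x. excess (exp (\<kappa> t)) r (w x) \<partial>lborel)"
    have \<kappa>t: "0 \<le> \<kappa> t" using \<kappa>0[of t] t by simp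
    have LSt: "I - Phi M \<le> C r * M + D r * e"
      unfolding I_def M_def using r \<kappa>t by (intro log_sobolev_trunc[OF J LS Dr _ _ wH E]) auto
    have iM: "integrable lborel (\<lambda>x. min \<bar>w x\<bar> (exp (\<kappa> t)) powr r)"
      and iX: "integrable lborel (\<lambda>x. excess (exp (\<kappa> t)) r (w x))"
      and iI: "integrable lborel (\<lambda>x. Phi (min \<bar>w x\<bar> (exp (\<kappa> t)) powr r))"
      using r w2 \<kappa>t by (auto intro!: integrable_min_powr integrable_excess integrable_Phi_trunc)
    have NMX: "N t = M + X"
      unfolding N_def M_def X_def lin_powr_def w_def[symmetric] r_def[symmetric] using iM iX by simp
    have M0: "0 \<le> M" and X0: "0 \<le> X"
      unfolding M_def X_def using r by (auto intro!: Bochner_Integration.integral_nonneg excess_nonneg)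
    have Npos: "0 < N t" using above by (meson exp_gt_zero less_trans)
    have "(N has_real_derivative (\<integral>x. lin_powr_dt (\<kappa> t) (\<kappa>' t) r r' (w x) \<partial>lborel)
       + (\<integral>x. r * tpow (exp (\<kappa> t)) r (w x) * v t x \<partial>lborel)) (at t)"
      unfolding N_def r_def r'_def w_def
    \<comment> \<open>The radius keeps times between t / 2 and T, so the exponents stay above q (t /
      2) > 2. The bound Q (1 + K) + \<beta> serves both q' \<le> Q and |\<kappa>'| \<le> Q K +
      \<beta>.\<close>
    proof (rule has_real_derivative_integral_lin_powr[where \<delta> = "min (t / 2) (T - t)" and ?r0.0 = "q (t / 2)"
          and \<kappa>' = \<kappa>' and q' = "\<lambda>t. (q t)\<^sup>2 / D (q t)" and R = R and K = K and Q = "Q * (1 + K) + \<beta>"])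
      show "0 < min (t / 2) (T - t)" using t by simp
      show "v t \<in> borel_measurable lborel" "integrable lborel (\<lambda>x. (v t x)\<^sup>2)"
        using v(1)[OF t(1)] unfolding memLp_2_iff by blast+
      show "((\<lambda>h. \<integral>x. ((u (t + h) x - u t x) / h - v t x)\<^sup>2 \<partial>lborel) \<longlongrightarrow> 0) (at 0)"
        using v(2)[OF t(1)] by (simp add: tendsto_lpnorm_2_iff)
      show "2 < q (t / 2)" using qmono[of 0 "t / 2"] t q0 p by simp
      fix \<tau> assume "\<tau> \<in> ball t (min (t / 2) (T - t))"
      then have \<tau>: "t / 2 < \<tau>" "\<tau> < T" by (auto simp: dist_real_def abs_if split: if_splits)
      then have \<tau>': "0 < \<tau>" "\<tau> \<in> {0..T}" using t by auto
      show "u \<tau> \<in> borel_measurable lborel" "integrable lborel (\<lambda>x. (u \<tau> x)\<^sup>2)"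
        using um[of \<tau>] u2[of \<tau>] \<tau>' by auto
      show "(\<kappa> has_real_derivative \<kappa>' \<tau>) (at \<tau>)" by (rule d\<kappa>)
      show "(q has_real_derivative (q \<tau>)\<^sup>2 / D (q \<tau>)) (at \<tau>)" using dq \<tau> \<tau>' by simp
      show "q (t / 2) \<le> q \<tau>" using qmono[of "t / 2" \<tau>] \<tau> t by simp
      show "q \<tau> \<le> R" by (rule qR[OF \<tau>'(2)])
      show k0: "0 \<le> \<kappa> \<tau>" and kK: "\<kappa> \<tau> \<le> K" using \<kappa>0[of \<tau>] \<kappa>K[of \<tau>] \<tau>' by auto
      have "0 \<le> Q * K" using Qpos k0 kK by simp
      then show "\<bar>(q \<tau>)\<^sup>2 / D (q \<tau>)\<bar> \<le> Q * (1 + K) + \<beta>"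
        using dqpos[OF \<tau>'(2)] Q[OF \<tau>'(2)] \<beta>0 by (simp add: distrib_left)
      have "Q * \<kappa> \<tau> \<le> Q * K" "0 \<le> Q * \<kappa> \<tau>" using Qpos k0 kK by auto
      then show "\<bar>\<kappa>' \<tau>\<bar> \<le> Q * (1 + K) + \<beta>"
        using Qpos \<beta>0 unfolding \<kappa>'_def distrib_left by linarith
    qed
    moreover have "(\<integral>x. lin_powr_dt (\<kappa> t) (\<kappa>' t) r r' (w x) \<partial>lborel)
        = r' / r * (I + (1 + r * \<kappa> t) * X) + (r - 1) * \<kappa>' t * X"
      unfolding lin_powr_dt_def I_def X_def using iX iI by simp
    moreover have "(\<integral>x. r * tpow (exp (\<kappa> t)) r (w x) * v t x \<partial>lborel) = - (r * e)"
      by (simp add: e_def mult.assoc mult.commute[of "v t _"])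
    moreover have "r' / r = r / D r"
      using r by (simp add: r'_def r_def power2_eq_square)
    ultimately have dN: "(N has_real_derivative
        r / D r * (I + (1 + r * \<kappa> t) * X) + (r - 1) * \<kappa>' t * X - r * e) (at t)"
      by simp
    have "((\<lambda>t. ln (N t)) has_real_derivative
       1 / N t * (r / D r * (I + (1 + r * \<kappa> t) * X) + (r - 1) * \<kappa>' t * X - r * e)) (at t)"
      by (rule DERIV_chain2[OF DERIV_ln_divide[OF Npos] dN])
    from DERIV_divide[OF this dq[OF t]]
    have "((\<lambda>t. ln (N t) / q t) has_real_derivative
       ((r / D r * (I + (1 + r * \<kappa> t) * X) + (r - 1) * \<kappa>' t * X - r * e) / N t * q t - ln (N t) * r') / (q t * q t)) (at t)"
      using qpos[OF tT] by (simp add: r'_def)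
    \<comment> \<open>As q' / q^2 = 1 / D, the quotient rule gives - ln N / D, which cancels the ln
      N that the entropy inequality leaves.\<close>
    moreover have "((r / D r * (I + (1 + r * \<kappa> t) * X) + (r - 1) * \<kappa>' t * X - r * e) / N t * q t - ln (N t) * r') / (q t * q t)
       = (r / D r * (I + (1 + r * \<kappa> t) * X) + (r - 1) * \<kappa>' t * X - r * e) / (N t * r) - ln (N t) / D r"
    proof -
      have "(A / n * r - l * (r\<^sup>2 / d)) / (r * r) = A / (n * r) - l / d" if "0 < n" "0 < d" for A n l d
        using that r by (simp add: field_simps power2_eq_square)
      from this[OF Npos Dr] show ?thesis by (simp add: r_def r'_def)
    qed
    moreover have "(r / D r * (I + (1 + r * \<kappa> t) * X) + (r - 1) * \<kappa>' t * X - r * e) / (N t * r) - ln (N t) / D r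
        \<le> C r / D r + max 0 (\<bar>C r / D r\<bar> - B)"
    proof (rule entropy_differential_inequality[OF Dr _ r(2) M0 X0 NMX Npos LSt])
      show "\<kappa>' t = - (Q * \<kappa> t + (Q * (1 + \<Lambda>) + B * R))" by (simp add: \<kappa>'_def \<beta>_def)
      show "r\<^sup>2 / D r \<le> Q" using Q[OF tT] by (simp add: r_def)
      have "r * (- \<Lambda>) \<le> r * (a + integral {0..t} g)"
        using \<Lambda>[OF tT] r by (intro mult_left_mono) auto
      also have "\<dots> < ln (N t)"
        using above Npos by (metis exp_gt_zero ln_exp ln_less_cancel_iff r_def)
      finally show "- (r * \<Lambda>) \<le> ln (N t)" by simp
    qed (use r \<kappa>t \<Lambda>0 B in auto)
    ultimately show "\<exists>d\<le>g t. ((\<lambda>t. ln (N t) / q t) has_real_derivative d) (at t)"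
      by (auto simp: g_def c_def r_def)
  qed
  moreover have "(\<integral>x. min \<bar>u T x\<bar> (exp k) powr (q T) \<partial>lborel) \<le> N T"
    unfolding N_def \<kappa>_T
  proof (rule integral_mono)
    have 2: "2 \<le> q T" using qge[of T] p T by simp
    then show "integrable lborel (\<lambda>x. min \<bar>u T x\<bar> (exp k) powr q T)"
      "integrable lborel (\<lambda>x. lin_powr (exp k) (q T) (u T x))"
      using um[of T] u2[of T] T by (auto intro!: integrable_min_powr integrable_lin_powr)
    show "min \<bar>u T x\<bar> (exp k) powr q T \<le> lin_powr (exp k) (q T) (u T x)" for x
      using excess_nonneg[of "exp k" "q T"] 2 by (simp add: lin_powr_def)
  qed
  ultimately show ?thesis by (simp add: g_def c_def)
qed

section \<open>Removal of the truncation\<close>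

text \<open>Fatou's lemma, in the form used both for removing the truncation and for passing to
  general data.\<close>

lemma nn_integral_le_of_tendsto:
  fixes h :: "nat \<Rightarrow> 'b \<Rightarrow> ennreal"
  assumes [measurable]: "\<And>n. h n \<in> borel_measurable M"
    and lim: "AE x in M. (\<lambda>n. h n x) \<longlonglongrightarrow> H x"
    and le: "\<forall>\<^sub>F n in sequentially. (\<integral>\<^sup>+x. h n x \<partial>M) \<le> b"
  shows "(\<integral>\<^sup>+x. H x \<partial>M) \<le> b"
proof -
  have "(\<integral>\<^sup>+x. H x \<partial>M) = (\<integral>\<^sup>+x. liminf (\<lambda>n. h n x) \<partial>M)"
  proof (rule nn_integral_cong_AE)
    show "AE x in M. H x = liminf (\<lambda>n. h n x)"
      using lim by eventually_elim (simp add: lim_imp_Liminf)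
  qed
  also have "\<dots> \<le> liminf (\<lambda>n. \<integral>\<^sup>+x. h n x \<partial>M)"
    by (rule nn_integral_liminf) measurable
  also have "\<dots> \<le> liminf (\<lambda>n. b)"
    by (rule Liminf_mono[OF le])
  also have "\<dots> = b" by (simp add: Liminf_const)
  finally show ?thesis .
qed

text \<open>The cost of the threshold vanishes: at each s the tail is 0 once n \<ge> |c s|, and it
  is dominated by |c|.\<close>

lemma tendsto_integral_add_tail:
  fixes c :: "real \<Rightarrow> real"
  assumes c: "c absolutely_integrable_on {0..T}"
  shows "(\<lambda>n. integral {0..T} (\<lambda>s. c s + max 0 (\<bar>c s\<bar> - real n))) \<longlonglongrightarrow> integral {0..T} c"
proof (rule dominated_convergence(2)[where h = "\<lambda>s. \<bar>c s\<bar> + \<bar>c s\<bar>"])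
  have ci: "c integrable_on {0..T}" and absc: "(\<lambda>t. \<bar>c t\<bar>) integrable_on {0..T}"
    using c by (auto simp: absolutely_integrable_on_def)
  show "(\<lambda>s. c s + max 0 (\<bar>c s\<bar> - real n)) integrable_on {0..T}" for n
    by (rule integrable_add_tail[OF c])
  show "(\<lambda>s. \<bar>c s\<bar> + \<bar>c s\<bar>) integrable_on {0..T}" by (intro integrable_add absc)
  show "norm (c s + max 0 (\<bar>c s\<bar> - real n)) \<le> \<bar>c s\<bar> + \<bar>c s\<bar>" for n s by auto
  show "(\<lambda>n. c s + max 0 (\<bar>c s\<bar> - real n)) \<longlonglongrightarrow> c s" for s
  proof (rule tendsto_eventually)
    obtain N :: nat where "\<bar>c s\<bar> \<le> real N" using real_arch_simple by blast
    then have "c s + max 0 (\<bar>c s\<bar> - real n) = c s" if "N \<le> n" for n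
      using that by (simp add: max_def)
    then show "\<forall>\<^sub>F n in sequentially. c s + max 0 (\<bar>c s\<bar> - real n) = c s"
      by (auto simp: eventually_sequentially)
  qed
qed

text \<open>Two limits in this order: for fixed B the level goes to infinity by Fatou, since the
  bound depends on B alone; then B goes to infinity. A number s > 0 replaces the norm of the datum
  because its logarithm is taken and the norm may be 0.\<close>

lemma l2_solution_hypercontractive:
  fixes J :: "'a::euclidean_space \<Rightarrow> 'a \<Rightarrow> real" and u :: "real \<Rightarrow> 'a \<Rightarrow> real"
  assumes J: "levy_kernel J" and p: "2 \<le> p"
    and D: "\<And>r. p \<le> r \<Longrightarrow> 0 < D r" and LS: "\<And>r. p \<le> r \<Longrightarrow> log_sobolev J r (C r) (D r)"
    and T: "0 \<le> T" and q0: "q 0 = p" and contq: "continuous_on {0..T} q"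
    and qge: "\<And>t. t \<in> {0..T} \<Longrightarrow> p \<le> q t"
    and dq: "\<And>t. 0 < t \<Longrightarrow> t < T \<Longrightarrow> (q has_real_derivative (q t)\<^sup>2 / D (q t)) (at t)"
    and contdq: "continuous_on {0..T} (\<lambda>t. (q t)\<^sup>2 / D (q t))"
    and c: "(\<lambda>t. C (q t) / D (q t)) absolutely_integrable_on {0..T}"
    and sol: "l2_solution J f u" and f: "memLp p f"
    and s: "0 < s" "(\<integral>x. \<bar>f x\<bar> powr p \<partial>lborel) \<le> s powr p"
  shows "(\<integral>\<^sup>+x. ennreal (\<bar>u T x\<bar> powr q T) \<partial>lborel)
    \<le> ennreal ((s * exp (integral {0..T} (\<lambda>t. C (q t) / D (q t)))) powr q T)"
proof (cases "T = 0")
  case True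
  have "AE x in lborel. u 0 x = f x" using sol by (simp add: l2_solution_def)
  then have "(\<integral>\<^sup>+x. ennreal (\<bar>u 0 x\<bar> powr p) \<partial>lborel) = (\<integral>\<^sup>+x. ennreal (\<bar>f x\<bar> powr p) \<partial>lborel)"
    by (intro nn_integral_cong_AE) (auto elim!: eventually_mono)
  also have "\<dots> = ennreal (\<integral>x. \<bar>f x\<bar> powr p \<partial>lborel)"
    using f by (intro nn_integral_eq_integral) (auto simp: memLp_def)
  also have "\<dots> \<le> ennreal (s powr p)" using s by (intro ennreal_leI)
  finally show ?thesis using True q0 by simp
next
  case False
  with T have T: "0 < T" by simp
  define w where "w = u T"
  define r where "r = q T"
  have r: "2 \<le> r" using qge[of T] T p by (simp add: r_def)
  have "memLp 2 w" using sol T by (simp add: l2_solution_def w_def)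
  then have [measurable]: "w \<in> borel_measurable lborel" and w2: "integrable lborel (\<lambda>x. (w x)\<^sup>2)"
    unfolding memLp_2_iff by blast+
  obtain Q where Q: "\<And>t. t \<in> {0..T} \<Longrightarrow> (q t)\<^sup>2 / D (q t) \<le> Q"
    using continuous_attains_sup[OF compact_Icc _ contdq] T
    by (metis atLeastAtMost_iff empty_iff less_imp_le order_refl)
  have a: "(\<integral>x. \<bar>f x\<bar> powr p \<partial>lborel) \<le> exp (p * ln s)"
    using s by (simp add: powr_def)
  let ?Y = "\<lambda>B. integral {0..T} (\<lambda>s. C (q s) / D (q s) + max 0 (\<bar>C (q s) / D (q s)\<bar> - B))"
  have *: "(\<integral>\<^sup>+x. ennreal (\<bar>w x\<bar> powr r) \<partial>lborel) \<le> ennreal (exp (r * (ln s + ?Y B)))" if "0 \<le> B" for B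
  proof (rule nn_integral_le_of_tendsto)
    show "AE x in lborel. (\<lambda>n. ennreal (min \<bar>w x\<bar> (exp (real n)) powr r)) \<longlonglongrightarrow> ennreal (\<bar>w x\<bar> powr r)"
    proof (intro AE_I2 tendsto_eventually)
      fix x
      obtain n0 :: nat where n0: "\<bar>w x\<bar> \<le> real n0" using real_arch_simple by blast
      have "min \<bar>w x\<bar> (exp (real n)) = \<bar>w x\<bar>" if "n0 \<le> n" for n
      proof (rule min_absorb1)
        have "real n0 \<le> real n" using that by simp
        then show "\<bar>w x\<bar> \<le> exp (real n)"
          using n0 exp_ge_add_one_self[of "real n"] by linarith
      qed
      then show "\<forall>\<^sub>F n in sequentially. ennreal (min \<bar>w x\<bar> (exp (real n)) powr r) = ennreal (\<bar>w x\<bar> powr r)"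
        by (intro eventually_sequentiallyI[of n0]) simp
    qed
    show "\<forall>\<^sub>F n in sequentially. (\<integral>\<^sup>+x. ennreal (min \<bar>w x\<bar> (exp (real n)) powr r) \<partial>lborel)
        \<le> ennreal (exp (r * (ln s + ?Y B)))"
    proof (intro always_eventually allI)
      fix n
      have "(\<integral>\<^sup>+x. ennreal (min \<bar>w x\<bar> (exp (real n)) powr r) \<partial>lborel)
          = ennreal (\<integral>x. min \<bar>w x\<bar> (exp (real n)) powr r \<partial>lborel)"
        using w2 r by (intro nn_integral_eq_integral integrable_min_powr) auto
      also have "\<dots> \<le> ennreal (exp (r * (ln s + ?Y B)))"
        unfolding w_def r_def
        by (intro ennreal_leI l2_solution_integral_bound[OF J p D LS T q0 contq qge dq Q c sol f a that]) auto
      finally show "(\<integral>\<^sup>+x. ennreal (min \<bar>w x\<bar> (exp (real n)) powr r) \<partial>lborel)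
        \<le> ennreal (exp (r * (ln s + ?Y B)))" .
    qed
  qed measurable
  have "(\<lambda>n. ennreal (exp (r * (ln s + ?Y (real n))))) \<longlonglongrightarrow> ennreal (exp (r * (ln s + integral {0..T} (\<lambda>t. C (q t) / D (q t)))))"
    by (intro tendsto_intros tendsto_integral_add_tail c)
  then have "(\<integral>\<^sup>+x. ennreal (\<bar>w x\<bar> powr r) \<partial>lborel)
      \<le> ennreal (exp (r * (ln s + integral {0..T} (\<lambda>t. C (q t) / D (q t)))))"
    by (rule LIMSEQ_le_const) (intro exI[of _ 0] allI impI *, simp)
  also have "exp (r * (ln s + integral {0..T} (\<lambda>t. C (q t) / D (q t))))
      = (s * exp (integral {0..T} (\<lambda>t. C (q t) / D (q t)))) powr r"
    using s by (simp add: powr_def ln_mult)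
  finally show ?thesis by (simp add: w_def r_def)
qed

section \<open>Passage to data in L^p\<close>

lemma powr_add_le_weighted:
  fixes a b p \<theta> :: real
  assumes p: "1 \<le> p" and \<theta>: "0 < \<theta>" "\<theta> < 1"
  shows "\<bar>a + b\<bar> powr p \<le> (1 - \<theta>) powr (1 - p) * \<bar>a\<bar> powr p + \<theta> powr (1 - p) * \<bar>b\<bar> powr p"
proof -
  define x y where "x = \<bar>a\<bar> / (1 - \<theta>)" and "y = \<bar>b\<bar> / \<theta>"
  define z where "z = (1 - \<theta>) * x + \<theta> * y"
  have nn: "0 \<le> x" "0 \<le> y" "0 \<le> z" using \<theta> by (auto simp: x_def y_def z_def)
  have "\<bar>a + b\<bar> \<le> z" using \<theta> by (simp add: z_def x_def y_def)
  then have "\<bar>a + b\<bar> powr p \<le> z powr p" using p by (intro powr_mono2) auto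
  \<comment> \<open>Jensen's inequality for two points: z is the weighted mean of x and y, so the
    inserted linear terms cancel, and each bracket is a tangent at z.\<close>
  also have "\<dots> = (1 - \<theta>) * (z powr p + p * z powr (p - 1) * (x - z)) + \<theta> * (z powr p + p * z powr (p - 1) * (y - z))"
    unfolding z_def by (simp add: algebra_simps)
  also have "\<dots> \<le> (1 - \<theta>) * x powr p + \<theta> * y powr p"
    using \<theta> nn p by (intro add_mono mult_left_mono powr_above_tangent) auto
  also have "\<dots> = (1 - \<theta>) powr (1 - p) * \<bar>a\<bar> powr p + \<theta> powr (1 - p) * \<bar>b\<bar> powr p"
    using \<theta> by (simp add: x_def y_def powr_divide powr_diff)
  finally show ?thesis .
qed

lemma memLp_diff:
  assumes p: "1 \<le> p" and "memLp p f" "memLp p g"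
  shows "memLp p (\<lambda>x. f x - g x)"
proof -
  have [measurable]: "f \<in> borel_measurable lborel" "g \<in> borel_measurable lborel"
    and i: "integrable lborel (\<lambda>x. \<bar>f x\<bar> powr p)" "integrable lborel (\<lambda>x. \<bar>g x\<bar> powr p)"
    using assms(2,3) unfolding memLp_def by blast+
  have "integrable lborel (\<lambda>x. \<bar>f x - g x\<bar> powr p)"
  proof (rule Bochner_Integration.integrable_bound)
    show "integrable lborel (\<lambda>x. (1 - 1 / 2) powr (1 - p) * \<bar>f x\<bar> powr p + (1 / 2) powr (1 - p) * \<bar>- g x\<bar> powr p)"
      using i by simp
    show "AE x in lborel. norm (\<bar>f x - g x\<bar> powr p)
       \<le> norm ((1 - 1 / 2) powr (1 - p) * \<bar>f x\<bar> powr p + (1 / 2) powr (1 - p) * \<bar>- g x\<bar> powr p)"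
    proof (rule AE_I2)
      fix x
      show "norm (\<bar>f x - g x\<bar> powr p)
       \<le> norm ((1 - 1 / 2) powr (1 - p) * \<bar>f x\<bar> powr p + (1 / 2) powr (1 - p) * \<bar>- g x\<bar> powr p)"
        using powr_add_le_weighted[OF p, of "1 / 2" "f x" "- g x"] by simp
    qed
  qed measurable
  then show ?thesis unfolding memLp_def by simp
qed

lemma tendsto_lpnorm_zero_iff:
  assumes "0 < p"
  shows "((\<lambda>n. lpnorm p (f n)) \<longlongrightarrow> 0) F \<longleftrightarrow> ((\<lambda>n. \<integral>x. \<bar>f n x\<bar> powr p \<partial>lborel) \<longlongrightarrow> 0) F"
proof
  assume "((\<lambda>n. lpnorm p (f n)) \<longlongrightarrow> 0) F"
  from tendsto_zero_powrI[OF this tendsto_const always_eventually, of p]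
  show "((\<lambda>n. \<integral>x. \<bar>f n x\<bar> powr p \<partial>lborel) \<longlongrightarrow> 0) F"
    using assms by (simp add: lpnorm_def powr_powr)
next
  assume "((\<lambda>n. \<integral>x. \<bar>f n x\<bar> powr p \<partial>lborel) \<longlongrightarrow> 0) F"
  from tendsto_zero_powrI[OF this tendsto_const always_eventually, of "1 / p"]
  show "((\<lambda>n. lpnorm p (f n)) \<longlongrightarrow> 0) F"
    using assms by (simp add: lpnorm_def)
qed

text \<open>In the weighted convexity inequality \<theta> is first taken so small that the factor in
  front of the integral of |g|^p keeps the value below m; the large factor in front of |f n - g|^p
  is then harmless as n grows.\<close>

lemma eventually_integral_powr_less:
  assumes p: "1 \<le> p" and g: "memLp p g" and f: "\<And>n::nat. memLp p (f n)"
    and lim: "(\<lambda>n. lpnorm p (\<lambda>x. f n x - g x)) \<longlonglongrightarrow> 0"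
    and m: "(\<integral>x. \<bar>g x\<bar> powr p \<partial>lborel) < m"
  shows "\<forall>\<^sub>F n in sequentially. (\<integral>x. \<bar>f n x\<bar> powr p \<partial>lborel) < m"
proof -
  define L where "L = (\<integral>x. \<bar>g x\<bar> powr p \<partial>lborel)"
  have "((\<lambda>\<theta>. (1 - \<theta>) powr (1 - p) * L) \<longlongrightarrow> (1 - 0) powr (1 - p) * L) (at_right 0)"
    by (intro tendsto_intros) auto
  then have "\<forall>\<^sub>F \<theta> in at_right 0. (1 - \<theta>) powr (1 - p) * L < m"
    using m by (intro order_tendstoD(2)) (auto simp: L_def)
  moreover have "\<forall>\<^sub>F \<theta> in at_right 0. 0 < \<theta> \<and> \<theta> < (1::real)"
    using eventually_at_right_real[of 0 1] by simp
  ultimately have "\<forall>\<^sub>F \<theta> in at_right 0. (1 - \<theta>) powr (1 - p) * L < m \<and> 0 < \<theta> \<and> \<theta> < (1::real)"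
    by eventually_elim simp
  from eventually_happens[OF this] obtain \<theta> where \<theta>: "(1 - \<theta>) powr (1 - p) * L < m" "0 < \<theta>" "\<theta> < 1"
    by (auto simp: trivial_limit_at_right_real)
  have le: "(\<integral>x. \<bar>f n x\<bar> powr p \<partial>lborel) \<le>
     (1 - \<theta>) powr (1 - p) * L + \<theta> powr (1 - p) * (\<integral>x. \<bar>f n x - g x\<bar> powr p \<partial>lborel)" for n
  proof -
    have i: "integrable lborel (\<lambda>x. \<bar>g x\<bar> powr p)" "integrable lborel (\<lambda>x. \<bar>f n x\<bar> powr p)"
       "integrable lborel (\<lambda>x. \<bar>f n x - g x\<bar> powr p)"
      using g f memLp_diff[OF p f g] by (auto simp: memLp_def)
    have "\<bar>f n x\<bar> powr p \<le> (1 - \<theta>) powr (1 - p) * \<bar>g x\<bar> powr p + \<theta> powr (1 - p) * \<bar>f n x - g x\<bar> powr p" for x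
      using powr_add_le_weighted[OF p \<theta>(2,3), of "g x" "f n x - g x"] by simp
    then have "(\<integral>x. \<bar>f n x\<bar> powr p \<partial>lborel) \<le>
      (\<integral>x. (1 - \<theta>) powr (1 - p) * \<bar>g x\<bar> powr p + \<theta> powr (1 - p) * \<bar>f n x - g x\<bar> powr p \<partial>lborel)"
      using i by (intro integral_mono) auto
    also have "\<dots> = (1 - \<theta>) powr (1 - p) * L + \<theta> powr (1 - p) * (\<integral>x. \<bar>f n x - g x\<bar> powr p \<partial>lborel)"
      using i by (simp add: L_def)
    finally show ?thesis .
  qed
  have "(\<lambda>n. \<integral>x. \<bar>f n x - g x\<bar> powr p \<partial>lborel) \<longlonglongrightarrow> 0"
    using lim p by (simp add: tendsto_lpnorm_zero_iff)
  then have "(\<lambda>n. (1 - \<theta>) powr (1 - p) * L + \<theta> powr (1 - p) * (\<integral>x. \<bar>f n x - g x\<bar> powr p \<partial>lborel))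
     \<longlonglongrightarrow> (1 - \<theta>) powr (1 - p) * L + \<theta> powr (1 - p) * 0"
    by (intro tendsto_intros)
  then have "\<forall>\<^sub>F n in sequentially. (1 - \<theta>) powr (1 - p) * L + \<theta> powr (1 - p) * (\<integral>x. \<bar>f n x - g x\<bar> powr p \<partial>lborel) < m"
    using \<theta> by (intro order_tendstoD(2)) auto
  then show ?thesis
    by eventually_elim (rule le_less_trans[OF le])
qed

lemma lpnorm_tendsto_AE_subseq:
  assumes p: "1 \<le> p" and f: "\<And>n::nat. memLp p (f n)" and g: "memLp p g"
    and lim: "(\<lambda>n. lpnorm p (\<lambda>x. f n x - g x)) \<longlonglongrightarrow> 0"
  obtains \<rho> :: "nat \<Rightarrow> nat" where "strict_mono \<rho>" "AE x in lborel. (\<lambda>n. f (\<rho> n) x) \<longlonglongrightarrow> g x"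
proof -
  have "(\<lambda>n. \<integral>x. norm (\<bar>f n x - g x\<bar> powr p) \<partial>lborel) \<longlonglongrightarrow> 0"
    using lim p by (simp add: tendsto_lpnorm_zero_iff)
  moreover have "integrable lborel (\<lambda>x. \<bar>f n x - g x\<bar> powr p)" for n
    using memLp_diff[OF p f g] by (simp add: memLp_def)
  ultimately obtain \<rho> where \<rho>: "strict_mono \<rho>"
      "AE x in lborel. (\<lambda>n. \<bar>f (\<rho> n) x - g x\<bar> powr p) \<longlonglongrightarrow> 0"
    using tendsto_L1_AE_subseq[of lborel "\<lambda>n x. \<bar>f n x - g x\<bar> powr p"] by auto
  from \<rho>(2) have "AE x in lborel. (\<lambda>n. f (\<rho> n) x) \<longlonglongrightarrow> g x"
  proof eventually_elim
    case (elim x)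
    from tendsto_zero_powrI[OF this tendsto_const always_eventually, of "1 / p"]
    have "(\<lambda>n. \<bar>f (\<rho> n) x - g x\<bar>) \<longlonglongrightarrow> 0"
      using p by (simp add: powr_powr)
    then have "(\<lambda>n. f (\<rho> n) x - g x) \<longlonglongrightarrow> 0" by (rule tendsto_rabs_zero_cancel)
    then show ?case by (simp add: LIM_zero_iff)
  qed
  with \<rho>(1) show ?thesis by (rule that)
qed

text \<open>For any s above the norm of \<open>u0\<close> the approximating data eventually have
  norm below s, so the bound with s passes to the limit by Fatou along an almost everywhere
  convergent subsequence. Letting s decrease to the norm finishes, also when the norm is 0.\<close>

lemma lp_solution_hypercontractive:
  fixes J :: "'a::euclidean_space \<Rightarrow> 'a \<Rightarrow> real" and u :: "real \<Rightarrow> 'a \<Rightarrow> real"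
  assumes J: "levy_kernel J" and p: "2 \<le> p"
    and D: "\<And>r. p \<le> r \<Longrightarrow> 0 < D r" and LS: "\<And>r. p \<le> r \<Longrightarrow> log_sobolev J r (C r) (D r)"
    and T: "0 \<le> T" and q0: "q 0 = p" and contq: "continuous_on {0..T} q"
    and qge: "\<And>t. t \<in> {0..T} \<Longrightarrow> p \<le> q t"
    and dq: "\<And>t. 0 < t \<Longrightarrow> t < T \<Longrightarrow> (q has_real_derivative (q t)\<^sup>2 / D (q t)) (at t)"
    and contdq: "continuous_on {0..T} (\<lambda>t. (q t)\<^sup>2 / D (q t))"
    and c: "(\<lambda>t. C (q t) / D (q t)) absolutely_integrable_on {0..T}"
    and sol: "lp_solution J p u0 u"
  shows "memLp (q T) (u T) \<and>
    lpnorm (q T) (u T) \<le> exp (integral {0..T} (\<lambda>t. C (q t) / D (q t))) * lpnorm p u0"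
proof -
  define Y where "Y = integral {0..T} (\<lambda>t. C (q t) / D (q t))"
  define r where "r = q T"
  have r: "0 < r" using qge[of T] p T by (simp add: r_def)
  have p1: "1 \<le> p" using p by simp
  have u0: "memLp p u0" and uT: "memLp p (u T)" using sol T by (auto simp: lp_solution_def)
  \<comment> \<open>The approximating sequence may depend on the time; only the single time T is
    considered.\<close>
  obtain f w where fw: "\<And>n::nat. memLp p (f n)" "\<And>n. l2_solution J (f n) (w n)" "\<And>n. memLp p (w n T)"
      and lf: "(\<lambda>n. lpnorm p (\<lambda>x. f n x - u0 x)) \<longlonglongrightarrow> 0"
      and lw: "(\<lambda>n. lpnorm p (\<lambda>x. w n T x - u T x)) \<longlonglongrightarrow> 0"
    using sol T unfolding lp_solution_def by blast
  obtain \<rho> where \<rho>: "strict_mono \<rho>" "AE x in lborel. (\<lambda>n. w (\<rho> n) T x) \<longlonglongrightarrow> u T x"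
    using lpnorm_tendsto_AE_subseq[OF p1 fw(3) uT lw] by blast
  have wm [measurable]: "w n T \<in> borel_measurable borel" for n
    using fw(3)[of n] by (simp add: memLp_def)
  have um [measurable]: "u T \<in> borel_measurable borel" using uT by (simp add: memLp_def)
  have bound: "(\<integral>\<^sup>+x. ennreal (\<bar>u T x\<bar> powr r) \<partial>lborel) \<le> ennreal ((s * exp Y) powr r)"
    if s: "lpnorm p u0 < s" for s
  proof (rule nn_integral_le_of_tendsto)
    have L0: "0 \<le> lpnorm p u0" by (simp add: lpnorm_def)
    have "(\<integral>x. \<bar>u0 x\<bar> powr p \<partial>lborel) = lpnorm p u0 powr p"
      using p by (simp add: lpnorm_def powr_powr)
    also have "\<dots> < s powr p" using s L0 p by (intro powr_less_mono2) auto
    finally have "\<forall>\<^sub>F n in sequentially. (\<integral>x. \<bar>f n x\<bar> powr p \<partial>lborel) < s powr p"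
      by (rule eventually_integral_powr_less[OF p1 u0 fw(1) lf])
    then have "\<forall>\<^sub>F n in sequentially. (\<integral>x. \<bar>f (\<rho> n) x\<bar> powr p \<partial>lborel) < s powr p"
      by (rule eventually_subseq[OF \<rho>(1)])
    then show "\<forall>\<^sub>F n in sequentially. (\<integral>\<^sup>+x. ennreal (\<bar>w (\<rho> n) T x\<bar> powr r) \<partial>lborel) \<le> ennreal ((s * exp Y) powr r)"
    proof eventually_elim
      case (elim n)
      then show ?case
        unfolding r_def Y_def using s L0
        by (intro l2_solution_hypercontractive[OF J p D LS T q0 contq qge dq contdq c fw(2) fw(1)]) auto
    qed
    show "AE x in lborel. (\<lambda>n. ennreal (\<bar>w (\<rho> n) T x\<bar> powr r)) \<longlonglongrightarrow> ennreal (\<bar>u T x\<bar> powr r)"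
      using \<rho>(2)
    proof eventually_elim
      case (elim x)
      then have "(\<lambda>n. \<bar>w (\<rho> n) T x\<bar> powr r) \<longlonglongrightarrow> \<bar>u T x\<bar> powr r"
        using r by (intro tendsto_powr' tendsto_rabs) auto
      then show ?case by (rule tendsto_ennrealI)
    qed
  qed measurable
  have "(\<integral>\<^sup>+x. ennreal (\<bar>u T x\<bar> powr r) \<partial>lborel) < \<infinity>"
    by (rule le_less_trans[OF bound[of "lpnorm p u0 + 1"]]) auto
  then have int: "integrable lborel (\<lambda>x. \<bar>u T x\<bar> powr r)"
    by (intro integrableI_bounded) auto
  have "lpnorm r (u T) / exp Y \<le> s" if s: "lpnorm p u0 < s" for s
  proof -
    have s0: "0 < s" using s by (rule le_less_trans[rotated]) (simp add: lpnorm_def)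
    have "ennreal (\<integral>x. \<bar>u T x\<bar> powr r \<partial>lborel) \<le> ennreal ((s * exp Y) powr r)"
      using bound[OF s] by (subst nn_integral_eq_integral[OF int, symmetric]) auto
    then have "(\<integral>x. \<bar>u T x\<bar> powr r \<partial>lborel) \<le> (s * exp Y) powr r"
      by (simp add: ennreal_le_iff)
    then have "lpnorm r (u T) \<le> ((s * exp Y) powr r) powr (1 / r)"
      unfolding lpnorm_def using r by (intro powr_mono2) auto
    also have "\<dots> = s * exp Y" using r s0 by (simp add: powr_powr)
    finally show ?thesis by (simp add: divide_le_eq)
  qed
  then have "lpnorm r (u T) / exp Y \<le> lpnorm p u0" by (rule dense_ge)
  then have "lpnorm r (u T) \<le> exp Y * lpnorm p u0" by (simp add: divide_le_eq mult.commute)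
  with int um show ?thesis by (simp add: memLp_def r_def Y_def)
qed

section \<open>The exponent as integration variable, and the final assembly\<close>

lemma integral_exponent_substitution:
  fixes q C D :: "real \<Rightarrow> real"
  assumes T: "0 \<le> T" and qpos: "\<And>t. t \<in> {0..T} \<Longrightarrow> 0 < q t"
    and D: "\<And>t. t \<in> {0..T} \<Longrightarrow> 0 < D (q t)"
    and dq: "\<And>t. t \<in> {0..T} \<Longrightarrow> (q has_real_derivative (q t)\<^sup>2 / D (q t)) (at t within {0..T})"
    and c: "(\<lambda>t. C (q t) / D (q t)) absolutely_integrable_on {0..T}"
  shows "integral {0..T} (\<lambda>t. C (q t) / D (q t)) = integral {q 0..q T} (\<lambda>\<alpha>. C \<alpha> / \<alpha>\<^sup>2)"
proof -
  have contq: "continuous_on {0..T} q"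
    using dq by (rule DERIV_continuous_on)
  have mono: "q s < q t" if "0 \<le> s" "s < t" "t \<le> T" for s t
  proof (rule DERIV_pos_imp_increasing_open[OF that(2)])
    fix x assume x: "s < x" "x < t"
    have "(q has_real_derivative (q x)\<^sup>2 / D (q x)) (at x within {s<..<t})"
      by (rule has_field_derivative_subset[OF dq[of x]]) (use x that in auto)
    then have "(q has_real_derivative (q x)\<^sup>2 / D (q x)) (at x)"
      using x by (simp add: at_within_open[of x "{s<..<t}"])
    moreover have "0 < (q x)\<^sup>2 / D (q x)"
      using qpos[of x] D[of x] x that by simp
    ultimately show "\<exists>y. (q has_real_derivative y) (at x) \<and> 0 < y" by blast
  next
    show "continuous_on {s..t} q" using that by (intro continuous_on_subset[OF contq]) auto
  qed
  have inj: "inj_on q {0..T}"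
    by (rule linorder_inj_onI) (use mono in \<open>force+\<close>)
  have img: "q ` {0..T} = {q 0..q T}"
  proof
    show "q ` {0..T} \<subseteq> {q 0..q T}"
    proof clarify
      fix t assume t: "t \<in> {0..T}"
      show "q t \<in> {q 0..q T}"
        using mono[of 0 t] mono[of t T] t by (cases "t = 0"; cases "t = T") auto
    qed
    show "{q 0..q T} \<subseteq> q ` {0..T}"
      using IVT'[of q 0 _ T] T contq by force
  qed
  \<comment> \<open>With \<alpha> = q t the Jacobian is q^2 / D, so the weight 1 / \<alpha>^2 turns
    C(\<alpha>) into C / D. As C may be discontinuous, the substitution rule for injective
    differentiable maps and absolutely integrable functions is used.\<close>
  have eq: "\<bar>(q t)\<^sup>2 / D (q t)\<bar> * (C (q t) / (q t)\<^sup>2) = C (q t) / D (q t)" if "t \<in> {0..T}" for t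
    using qpos[OF that] D[OF that] by simp
  have "(\<lambda>t. \<bar>(q t)\<^sup>2 / D (q t)\<bar> * (C (q t) / (q t)\<^sup>2)) absolutely_integrable_on {0..T}"
    using c by (rule absolutely_integrable_spike[OF _ negligible_empty]) (use eq in auto)
  moreover have "integral {0..T} (\<lambda>t. \<bar>(q t)\<^sup>2 / D (q t)\<bar> * (C (q t) / (q t)\<^sup>2)) = integral {0..T} (\<lambda>t. C (q t) / D (q t))"
    using eq by (intro integral_cong) auto
  ultimately show ?thesis
    using has_absolute_integral_change_of_variables_1'[of "{0..T}" q "\<lambda>t. (q t)\<^sup>2 / D (q t)" "\<lambda>\<alpha>. C \<alpha> / \<alpha>\<^sup>2"
        "integral {0..T} (\<lambda>t. C (q t) / D (q t))"] dq inj
    unfolding img by simp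
qed

theorem theorem3p12:
  fixes J :: "'a::euclidean_space \<Rightarrow> 'a \<Rightarrow> real"
    and p :: real and C D :: "real \<Rightarrow> real"
    and q :: "real \<Rightarrow> real" and t_inf :: ereal and A :: "real \<Rightarrow> real"
  assumes "levy_kernel J"
    and "p \<ge> 2"
    and "\<And>r. r \<ge> p \<Longrightarrow> D r > 0"
    and "\<And>r. r \<ge> p \<Longrightarrow> log_sobolev J r (C r) (D r)"
    and "t_inf > 0"
    and "\<And>t. 0 \<le> t \<Longrightarrow> ereal t < t_inf \<Longrightarrow> q t \<ge> p"
    and "\<And>t. 0 \<le> t \<Longrightarrow> ereal t < t_inf \<Longrightarrow>
           (q has_real_derivative (q t)\<^sup>2 / D (q t)) (at t within {s. 0 \<le> s \<and> ereal s < t_inf})"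
    and "continuous_on {s. 0 \<le> s \<and> ereal s < t_inf} (\<lambda>t. (q t)\<^sup>2 / D (q t))"
    and "q 0 = p"
    and "filterlim (\<lambda>s. q (real_of_ereal s)) at_top (at_left t_inf)"
    and "\<And>t. 0 \<le> t \<Longrightarrow> ereal t < t_inf \<Longrightarrow>
           (\<lambda>s. C (q s) / D (q s)) absolutely_integrable_on {0..t}"
    and "\<And>t. 0 \<le> t \<Longrightarrow> ereal t < t_inf \<Longrightarrow>
           A t = exp (integral {0..t} (\<lambda>s. C (q s) / D (q s)))"
  shows "\<forall>t. 0 \<le> t \<and> ereal t < t_inf \<longrightarrow>
           A t = exp (integral {p..q t} (\<lambda>\<alpha>. C \<alpha> / \<alpha>\<^sup>2)) \<and>
           (\<forall>u0 u. memLp p u0 \<and> lp_solution J p u0 u \<longrightarrow>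
              memLp (q t) (u t) \<and> lpnorm (q t) (u t) \<le> A t * lpnorm p u0)"
proof (intro allI impI, elim conjE)
  fix T assume T: "0 \<le> T" "ereal T < t_inf"
  have sub: "{0..T} \<subseteq> {s. 0 \<le> s \<and> ereal s < t_inf}"
    by (auto intro: le_less_trans[OF _ T(2)])
  have qge: "p \<le> q t" if "t \<in> {0..T}" for t
    using assms(6)[of t] sub that by auto
  have dq: "(q has_real_derivative (q t)\<^sup>2 / D (q t)) (at t within {0..T})" if "t \<in> {0..T}" for t
    by (rule has_field_derivative_subset[OF assms(7) sub]) (use sub that in auto)
  have contq: "continuous_on {0..T} q"
    using dq by (rule DERIV_continuous_on)
  have dq': "(q has_real_derivative (q t)\<^sup>2 / D (q t)) (at t)" if "0 < t" "t < T" for t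
    using dq[of t] that by (simp add: at_within_Icc_at)
  have contdq: "continuous_on {0..T} (\<lambda>t. (q t)\<^sup>2 / D (q t))"
    by (rule continuous_on_subset[OF assms(8) sub])
  note c = assms(11)[OF T]
  have "A T = exp (integral {p..q T} (\<lambda>\<alpha>. C \<alpha> / \<alpha>\<^sup>2))"
    using integral_exponent_substitution[OF T(1) _ _ dq c] qge assms(2,3,9) assms(12)[OF T] by force
  moreover have "memLp (q T) (u T) \<and> lpnorm (q T) (u T) \<le> A T * lpnorm p u0"
    if "lp_solution J p u0 u" for u0 u
    unfolding assms(12)[OF T]
    by (rule lp_solution_hypercontractive[OF assms(1-4) T(1) assms(9) contq qge dq' contdq c that])
  ultimately show "A T = exp (integral {p..q T} (\<lambda>\<alpha>. C \<alpha> / \<alpha>\<^sup>2)) \<and>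
           (\<forall>u0 u. memLp p u0 \<and> lp_solution J p u0 u \<longrightarrow>
              memLp (q T) (u T) \<and> lpnorm (q T) (u T) \<le> A T * lpnorm p u0)"
    by blast
qed

end
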